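(* Let $(\Omega,\mathcal F,\mathbb P)$ be a complete probability space with an increasing sequence of sub-$\sigma$-algebras $(\mathcal F_n)_{n\ge0}$ such that $\mathcal F=\sigma(\bigcup_n\mathcal F_n)$ and every $\mathcal F_n$ is generated by countably many atoms. Let $p(\cdot):\Omega\to(0,\infty)$ be measurable with $0<p_-\le p_+<\infty$, and assume there is a constant $K_{p(\cdot)}\ge1$ depending only on $p(\cdot)$ such that $\mathbb P(A)^{p_-(A)-p_+(A)}\le K_{p(\cdot)}$ for every atom $A$ of every $\mathcal F_n$. If $(\mathcal F_n)_{n\ge0}$ is regular, then $$H^S_{p(\cdot)}=H_{p(\cdot)}^{\mathrm{at},2,\infty},\qquad H^M_{p(\cdot)}=H_{p(\cdot)}^{\mathrm{at},3,\infty}$$ with equivalent quasi-norms.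
   Context: For measurable $A\subset\Omega$, $p_-(A)=\operatorname{ess\,inf}_{x\in A}p(x)$, $p_+(A)=\operatorname{ess\,sup}_{x\in A}p(x)$; $p_\pm=p_\pm(\Omega)$, $\underline p=\min\{p_-,1\}$; $\|f\|_{p(\cdot)}=\inf\{\lambda>0:\int_\Omega(|f(x)|/\lambda)^{p(x)}d\mathbb P\le1\}$. $B\in\mathcal F_n$ is an atom of $\mathcal F_n$ if every $A\subset B$ with $A\in\mathcal F_n$ and $\mathbb P(A)<\mathbb P(B)$ satisfies $\mathbb P(A)=0$. $(\mathcal F_n)_{n\ge0}$ is regular if there is a constant $R>0$, independent of $n$, such that for all $n\ge1$ and $A\in\mathcal F_n$ there is $B\in\mathcal F_{n-1}$ with $A\subset B$ and $\mathbb P(B)\le R\,\mathbb P(A)$. $\mathbb E_n=\mathbb E(\cdot|\mathcal F_n)$. A martingale is a sequence $f=(f_n)_{n\ge0}\subset L_1(\Omega)$ with $\mathbb E_n(f_{n+1})=f_n$ for every $n\ge0$; $f_{-1}:=0$ and $d_nf=f_n-f_{n-1}$, $n\ge0$. $M(f)=\sup_{n\ge0}|f_n|$, $S(f)=(\sum_{k=0}^\infty|d_kf|^2)^{1/2}$; for a function $a$ these are applied to the martingale $a_n=\mathbb E_na$. $H^S_{p(\cdot)}$ (resp. $H^M_{p(\cdot)}$) is the space of martingales with $\|f\|_{H^S_{p(\cdot)}}=\|S(f)\|_{p(\cdot)}<\infty$ (resp. $\|f\|_{H^M_{p(\cdot)}}=\|M(f)\|_{p(\cdot)}<\infty$). A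 $(2,p(\cdot),\infty)$-atom (resp. $(3,p(\cdot),\infty)$-atom) is a measurable function $a$ for which there is a stopping time $\tau$ with respect to $(\mathcal F_n)$ (possibly taking the value $\infty$) such that $\mathbb E(a|\mathcal F_n)=0$ for all $n\le\tau$, i.e. on $\{n\le\tau\}$, and $\|S(a)\|_\infty$ (resp. $\|M(a)\|_\infty$) is at most $1/\|\chi_{\{\tau<\infty\}}\|_{p(\cdot)}$. For $d\in\{2,3\}$, $H_{p(\cdot)}^{\mathrm{at},d,\infty}$ is the space of all martingales $f=(f_n)_{n\ge0}$ such that $f_n=\sum_{k\in\mathbb Z}\mu_ka_n^k$, where $(a^k)_{k\in\mathbb Z}$ is a sequence of $(d,p(\cdot),\infty)$-atoms associated with stopping times $(\tau_k)_{k\in\mathbb Z}$, $a^k_n=\mathbb E_na^k$, and $(\mu_k)_{k\in\mathbb Z}$ is a sequence of positive numbers. For a fixed $0<t<\underline p$, $$\|f\|_{H_{p(\cdot)}^{\mathrm{at},d,\infty}}=\inf\left\|\left[\sum_{k\in\mathbb Z}\left(\frac{\mu_k\chi_{\{\tau_k<\infty\}}}{\|\chi_{\{\tau_k<\infty\}}\|_{p(\cdot)}}\right)^t\right]^{1/t}\right\|_{p(\cdot)},$$ the infimum being taken over all such decompositions of $f$.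
   Formalization: The Hardy spaces are restricted to martingales with f_0 = 0 a.e.: every atom has E(a|F_0) = 0, so atomic spaces contain only such martingales, while the constant martingale 1 lies in both Hardy spaces and makes the literal equalities false. *)

theory Defs
  imports "HOL-Probability.Probability"
begin

text \<open>
  Throughout, \<open>M\<close> is the probability space, \<open>F n\<close> the \<open>n\<close>-th sub-sigma-algebra (only
  \<open>sets (F n)\<close> matters, probabilities are always taken in \<open>M\<close>) and \<open>p\<close> the variable exponent.
  Martingales are sequences of representatives; identities between them hold almost everywhere.
  Maximal functions, square functions and quasi-norms may be infinite and take values in
  \<^typ>\<open>ennreal\<close>.
\<close>

definition ennpowr :: "ennreal \<Rightarrow> real \<Rightarrow> ennreal"
  where \<comment> \<open>only used with a positive exponent, whence \<open>\<infinity>\<close> to the power \<open>a\<close> is \<open>\<infinity>\<close>\<close>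
    "ennpowr u a = (if u = \<infinity> then \<infinity> else ennreal (enn2real u powr a))"

definition essinf :: "'a measure \<Rightarrow> ('a \<Rightarrow> ereal) \<Rightarrow> ereal"
  where "essinf M f = - esssup M (\<lambda>x. - f x)"

text \<open>
  On a null set \<open>A\<close> one gets \<open>p_minus = \<infinity>\<close> and \<open>p_plus = - \<infinity>\<close>. Null sets in \<open>F n\<close> are
  atoms in the sense of \<open>atom_of\<close> below, but as \<open>0 powr _ = 0\<close> they contribute nothing to
  the bound on \<open>measure M A powr (p_minus - p_plus)\<close>.
\<close>

definition p_minus :: "'a measure \<Rightarrow> ('a \<Rightarrow> real) \<Rightarrow> 'a set \<Rightarrow> ereal"
  where "p_minus M p A = essinf (restrict_space M A) (\<lambda>x. ereal (p x))"

definition p_plus :: "'a measure \<Rightarrow> ('a \<Rightarrow> real) \<Rightarrow> 'a set \<Rightarrow> ereal"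
  where "p_plus M p A = esssup (restrict_space M A) (\<lambda>x. ereal (p x))"

text \<open>The argument \<open>f\<close> plays the role of the absolute value of the function.\<close>

definition var_norm :: "'a measure \<Rightarrow> ('a \<Rightarrow> real) \<Rightarrow> ('a \<Rightarrow> ennreal) \<Rightarrow> ennreal"
  where "var_norm M p f =
    Inf {ennreal l | l. l > 0 \<and> (\<integral>\<^sup>+ x. ennpowr (f x / ennreal l) (p x) \<partial>M) \<le> 1}"

definition atom_of :: "'a measure \<Rightarrow> 'a measure \<Rightarrow> 'a set \<Rightarrow> bool"
  where "atom_of M G B \<longleftrightarrow> B \<in> sets G \<and>
    (\<forall>A \<in> sets G. A \<subseteq> B \<and> measure M A < measure M B \<longrightarrow> measure M A = 0)"

definition generated_by_countably_many_atoms :: "'a measure \<Rightarrow> 'a measure \<Rightarrow> bool"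
  where "generated_by_countably_many_atoms M G \<longleftrightarrow>
    (\<exists>C. countable C \<and> (\<forall>B\<in>C. atom_of M G B) \<and> sets G = sigma_sets (space M) C)"

definition regular_filtration :: "'a measure \<Rightarrow> (nat \<Rightarrow> 'a measure) \<Rightarrow> bool"
  where "regular_filtration M F \<longleftrightarrow>
    (\<exists>R>0. \<forall>n\<ge>1. \<forall>A \<in> sets (F n). \<exists>B \<in> sets (F (n - 1)).
       A \<subseteq> B \<and> measure M B \<le> R * measure M A)"

definition martingale :: "'a measure \<Rightarrow> (nat \<Rightarrow> 'a measure) \<Rightarrow> (nat \<Rightarrow> 'a \<Rightarrow> real) \<Rightarrow> bool"
  where "martingale M F f \<longleftrightarrow>
    (\<forall>n. integrable M (f n) \<and> (AE x in M. real_cond_exp M (F n) (f (Suc n)) x = f n x))"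

definition mart_diff :: "(nat \<Rightarrow> 'a \<Rightarrow> real) \<Rightarrow> nat \<Rightarrow> 'a \<Rightarrow> real"
  where "mart_diff f n x = f n x - (if n = 0 then 0 else f (n - 1) x)"

definition maximal_fun :: "(nat \<Rightarrow> 'a \<Rightarrow> real) \<Rightarrow> 'a \<Rightarrow> ennreal"
  where "maximal_fun f x = (SUP n. ennreal \<bar>f n x\<bar>)"

definition square_fun :: "(nat \<Rightarrow> 'a \<Rightarrow> real) \<Rightarrow> 'a \<Rightarrow> ennreal"
  where "square_fun f x = ennpowr (\<Sum>n. ennreal (\<bar>mart_diff f n x\<bar>\<^sup>2)) (1/2)"

text \<open>
  The spaces of martingales below are parametrised by an operator \<open>T\<close>, which is
  \<^const>\<open>square_fun\<close> or \<^const>\<open>maximal_fun\<close>.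
\<close>

definition hardy_norm ::
    "((nat \<Rightarrow> 'a \<Rightarrow> real) \<Rightarrow> 'a \<Rightarrow> ennreal) \<Rightarrow> 'a measure \<Rightarrow> ('a \<Rightarrow> real)
      \<Rightarrow> (nat \<Rightarrow> 'a \<Rightarrow> real) \<Rightarrow> ennreal"
  where "hardy_norm T M p f = var_norm M p (T f)"

definition hardy_space ::
    "((nat \<Rightarrow> 'a \<Rightarrow> real) \<Rightarrow> 'a \<Rightarrow> ennreal) \<Rightarrow> 'a measure \<Rightarrow> (nat \<Rightarrow> 'a measure) \<Rightarrow> ('a \<Rightarrow> real)
      \<Rightarrow> (nat \<Rightarrow> 'a \<Rightarrow> real) set"
  where "hardy_space T M F p = {f. martingale M F f \<and> hardy_norm T M p f < \<infinity>}"

text \<open>The filtration is extended by \<open>M\<close> at \<open>\<infinity>\<close>, where the condition is void.\<close>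

definition stopping_time_ext :: "'a measure \<Rightarrow> (nat \<Rightarrow> 'a measure) \<Rightarrow> ('a \<Rightarrow> enat) \<Rightarrow> bool"
  where "stopping_time_ext M F \<tau> \<longleftrightarrow>
    stopping_time (\<lambda>i. case i of enat n \<Rightarrow> F n | \<infinity> \<Rightarrow> M) \<tau>"

definition finite_ind :: "'a measure \<Rightarrow> ('a \<Rightarrow> enat) \<Rightarrow> 'a \<Rightarrow> ennreal"
  where "finite_ind M \<tau> = indicator {x \<in> space M. \<tau> x < \<infinity>}"

text \<open>
  A \<open>(2,p,\<infinity>)\<close>-atom is obtained for \<open>T = square_fun\<close>, a \<open>(3,p,\<infinity>)\<close>-atom for
  \<open>T = maximal_fun\<close>. Integrability of \<open>a\<close> is what makes \<open>E(a | F n)\<close> a martingale. If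
  \<open>\<tau> = \<infinity>\<close> almost everywhere, the bound is \<open>1 / 0 = \<infinity>\<close>.
\<close>

definition var_atom ::
    "((nat \<Rightarrow> 'a \<Rightarrow> real) \<Rightarrow> 'a \<Rightarrow> ennreal) \<Rightarrow> 'a measure \<Rightarrow> (nat \<Rightarrow> 'a measure) \<Rightarrow> ('a \<Rightarrow> real)
      \<Rightarrow> ('a \<Rightarrow> enat) \<Rightarrow> ('a \<Rightarrow> real) \<Rightarrow> bool"
  where "var_atom T M F p \<tau> a \<longleftrightarrow>
    integrable M a \<and> stopping_time_ext M F \<tau> \<and>
    (\<forall>n. AE x in M. enat n \<le> \<tau> x \<longrightarrow> real_cond_exp M (F n) a x = 0) \<and>
    esssup M (T (\<lambda>n. real_cond_exp M (F n) a)) \<le> 1 / var_norm M p (finite_ind M \<tau>)"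

definition atomic_decomposition ::
    "((nat \<Rightarrow> 'a \<Rightarrow> real) \<Rightarrow> 'a \<Rightarrow> ennreal) \<Rightarrow> 'a measure \<Rightarrow> (nat \<Rightarrow> 'a measure) \<Rightarrow> ('a \<Rightarrow> real)
      \<Rightarrow> (nat \<Rightarrow> 'a \<Rightarrow> real) \<Rightarrow> (int \<Rightarrow> real) \<Rightarrow> (int \<Rightarrow> 'a \<Rightarrow> enat) \<Rightarrow> (int \<Rightarrow> 'a \<Rightarrow> real) \<Rightarrow> bool"
  where "atomic_decomposition T M F p f \<mu> \<tau> a \<longleftrightarrow>
    (\<forall>k. \<mu> k > 0 \<and> var_atom T M F p (\<tau> k) (a k)) \<and>
    (\<forall>n. AE x in M. ((\<lambda>k. \<mu> k * real_cond_exp M (F n) (a k) x) has_sum f n x) UNIV)"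

text \<open>
  For \<open>\<tau> k = \<infinity>\<close> almost everywhere the \<open>k\<close>-th summand vanishes almost everywhere, as
  \<open>0 / 0 = 0\<close>.
\<close>

definition decomposition_norm ::
    "'a measure \<Rightarrow> ('a \<Rightarrow> real) \<Rightarrow> real \<Rightarrow> (int \<Rightarrow> real) \<Rightarrow> (int \<Rightarrow> 'a \<Rightarrow> enat) \<Rightarrow> ennreal"
  where "decomposition_norm M p t \<mu> \<tau> =
    var_norm M p (\<lambda>x. ennpowr
      (\<Sum>\<^sub>\<infinity>k\<in>UNIV. ennpowr
         (ennreal (\<mu> k) * finite_ind M (\<tau> k) x / var_norm M p (finite_ind M (\<tau> k))) t) (1/t))"

text \<open>
  The infimum over no decomposition is \<open>\<infinity>\<close>, so membership in the atomic space means that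
  there is a decomposition of finite size.
\<close>

definition atomic_norm ::
    "((nat \<Rightarrow> 'a \<Rightarrow> real) \<Rightarrow> 'a \<Rightarrow> ennreal) \<Rightarrow> 'a measure \<Rightarrow> (nat \<Rightarrow> 'a measure) \<Rightarrow> ('a \<Rightarrow> real)
      \<Rightarrow> real \<Rightarrow> (nat \<Rightarrow> 'a \<Rightarrow> real) \<Rightarrow> ennreal"
  where "atomic_norm T M F p t f =
    Inf {decomposition_norm M p t \<mu> \<tau> | \<mu> \<tau> a. atomic_decomposition T M F p f \<mu> \<tau> a}"

definition atomic_space ::
    "((nat \<Rightarrow> 'a \<Rightarrow> real) \<Rightarrow> 'a \<Rightarrow> ennreal) \<Rightarrow> 'a measure \<Rightarrow> (nat \<Rightarrow> 'a measure) \<Rightarrow> ('a \<Rightarrow> real)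
      \<Rightarrow> real \<Rightarrow> (nat \<Rightarrow> 'a \<Rightarrow> real) set"
  where "atomic_space T M F p t = {f. martingale M F f \<and> atomic_norm T M F p t f < \<infinity>}"

definition equivalent_on :: "'f set \<Rightarrow> ('f \<Rightarrow> ennreal) \<Rightarrow> ('f \<Rightarrow> ennreal) \<Rightarrow> bool"
  where "equivalent_on X N1 N2 \<longleftrightarrow>
    (\<exists>c C::real. c > 0 \<and> C > 0 \<and>
       (\<forall>f\<in>X. ennreal c * N1 f \<le> N2 f \<and> N2 f \<le> ennreal C * N1 f))"

text \<open>
  Every atom satisfies \<open>E(a | F 0) = 0\<close> because \<open>0 \<le> \<tau>\<close> everywhere; hence all members of the
  atomic spaces start at \<open>0\<close>, and a comparison with the Hardy spaces only makes sense under the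
  usual normalisation \<open>f 0 = 0\<close> of martingales (the constant martingale \<open>1\<close> belongs to the
  Hardy spaces but has no atomic decomposition).
\<close>

definition null_at_0 :: "'a measure \<Rightarrow> (nat \<Rightarrow> 'a \<Rightarrow> real) set"
  where "null_at_0 M = {f. AE x in M. f 0 x = 0}"

lemma atomic_space_null_at_0: "atomic_space T M F p t \<subseteq> null_at_0 M"
proof
  fix f assume "f \<in> atomic_space T M F p t"
  then have "atomic_norm T M F p t f < \<infinity>" by (simp add: atomic_space_def)
  then obtain \<mu> \<tau> a where d: "atomic_decomposition T M F p f \<mu> \<tau> a"
    unfolding atomic_norm_def by (auto simp: Inf_less_iff)
  have "AE x in M. real_cond_exp M (F 0) (a k) x = 0" for k
  proof -
    have "AE x in M. enat 0 \<le> \<tau> k x \<longrightarrow> real_cond_exp M (F 0) (a k) x = 0"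
      using d unfolding atomic_decomposition_def var_atom_def by blast
    then show ?thesis by (simp add: enat_0)
  qed
  then have "AE x in M. \<forall>k. real_cond_exp M (F 0) (a k) x = 0"
    by (simp add: AE_all_countable)
  moreover have "AE x in M. ((\<lambda>k. \<mu> k * real_cond_exp M (F 0) (a k) x) has_sum f 0 x) UNIV"
    using d unfolding atomic_decomposition_def by blast
  ultimately have "AE x in M. f 0 x = 0"
  proof eventually_elim
    case (elim x)
    then have "((\<lambda>k::int. 0 :: real) has_sum f 0 x) UNIV" by simp
    then show ?case by (metis has_sum_0 has_sum_unique)
  qed
  then show "f \<in> null_at_0 M" by (simp add: null_at_0_def)
qed

end

theory Submission
  imports Defs
begin

text \<open>
  The proof treats both operators at once: each is the supremum over \<open>n\<close> of a seminorm \<open>U\<close> of the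
  path up to the time \<open>n\<close> (locale \<open>seq_seminorm\<close>).

  An atomic decomposition bounds the Hardy norm with constant \<open>1\<close>. The operator is countably
  subadditive, and applied to an atom it is at most the indicator of \<open>\<tau> < \<infinity>\<close> divided by its norm;
  since \<open>t \<le> 1\<close>, the resulting sum is dominated by the \<open>t\<close>-sum in the atomic norm
  (\<open>hardy_norm_le_decomposition_norm\<close>).

  Conversely, let \<open>f 0 = 0\<close>, let \<open>l\<close> be a scale at which the modular of the operator applied to
  \<open>f\<close> is at most \<open>1\<close>, and let \<open>u n = U f n / l\<close>. The stopping time \<open>\<tau> k\<close> is the first \<open>n\<close> at which
  the present atom of \<open>F n\<close> contains points with \<open>u (n + 1) > 2 powr k\<close> in positive probability.
  Thus \<open>u \<le> 2 powr k\<close> up to \<open>\<tau> k\<close>, and the difference of \<open>f\<close> stopped at \<open>\<tau> (k + 1)\<close> and at \<open>\<tau> k\<close> is a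
  martingale on which the operator is at most \<open>4 l 2 powr k\<close>. It is bounded in \<open>L\<^sup>2\<close>, hence
  closed by an integrable function (\<open>martingale_closure\<close>), which after normalisation is the
  \<open>k\<close>-th atom. These differences telescope to \<open>f\<close>.

  It remains to bound the atomic norm by a multiple of \<open>l\<close>. Because the times \<open>\<tau> k\<close> increase, the
  sum in the norm is at every point a geometric one, comparable to its last term
  (\<open>decomposition_norm_le\<close>), so the task is to bound the sum over \<open>k \<ge> 0\<close> of the integrals of
  \<open>(2 ^ k) powr p\<close> over \<open>\<tau> k < \<infinity>\<close>. By regularity the set \<open>u (n + 1) > 2 ^ k\<close> fills a fixed
  proportion of each non-null atom \<open>Q\<close> of \<open>F n\<close> inside \<open>\<tau> k = n\<close>. The modular bound then limits \<open>2 ^ k\<close>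
  in terms of \<open>1 / prob Q\<close>, and the hypothesis on the oscillation of \<open>p\<close> on atoms makes
  the integrals of \<open>(2 ^ k) powr p\<close> over \<open>Q\<close> and over its part with \<open>u (n + 1) > 2 ^ k\<close> comparable
  (\<open>integral_const_powr_le\<close>). Summing over the disjoint atoms replaces \<open>\<tau> k < \<infinity>\<close> by the set where the
  supremum of \<open>u\<close> exceeds \<open>2 ^ k\<close> (\<open>integral_hitting_time_cover_le\<close>), and the sum over \<open>k\<close> is bounded by
  the modular of this supremum (\<open>integral_layers_le\<close>).
\<close>

section \<open>Powers and sums of extended nonnegative numbers\<close>

lemma ennpowr_ennreal: "0 \<le> r \<Longrightarrow> ennpowr (ennreal r) a = ennreal (r powr a)"
  by (simp add: ennpowr_def)

lemma ennpowr_top [simp]: "ennpowr \<top> a = \<top>"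
  by (simp add: ennpowr_def)

lemma ennpowr_0 [simp]: "ennpowr 0 a = 0"
  by (simp add: ennpowr_def)

lemma ennpowr_1 [simp]: "ennpowr 1 a = 1"
  by (simp add: ennpowr_def)

lemma ennpowr_mono:
  assumes "u \<le> v" "0 \<le> a" shows "ennpowr u a \<le> ennpowr v a"
proof (cases v)
  case (real r)
  then obtain s where "u = ennreal s" "0 \<le> s" "s \<le> r"
    using assms(1) by (cases u) (auto simp: ennreal_le_iff top_unique)
  then show ?thesis using real assms(2)
    by (auto simp: ennpowr_ennreal intro!: ennreal_leI powr_mono2)
qed simp

lemma ennpowr_inverse:
  assumes "0 < a" shows "ennpowr (ennpowr u a) (1 / a) = u"
  using assms by (cases u) (auto simp: ennpowr_ennreal powr_powr)

lemma borel_measurable_ennpowr [measurable]: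
  assumes [measurable]: "f \<in> borel_measurable M" "p \<in> borel_measurable M"
  shows "(\<lambda>x. ennpowr (f x) (p x)) \<in> borel_measurable M"
  unfolding ennpowr_def by measurable

lemma infsum_ennreal_le:
  fixes f :: "'i \<Rightarrow> ennreal"
  assumes "\<And>J. finite J \<Longrightarrow> sum f J \<le> C" shows "infsum f UNIV \<le> C"
  by (subst nonneg_infsum_complete) (auto intro!: SUP_least assms)

lemma sum_le_infsum_ennreal:
  fixes f :: "'i \<Rightarrow> ennreal"
  assumes "finite J" shows "sum f J \<le> infsum f UNIV"
  by (subst nonneg_infsum_complete) (auto intro!: SUP_upper assms)

text \<open>
  The inequality between the norms with exponents \<open>1\<close> and \<open>t \<le> 1\<close>: after division by the total,
  every summand is at most \<open>1\<close> and is not decreased by the power \<open>t\<close>.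
\<close>

lemma sum_le_ennpowr_sum:
  fixes b :: "'i \<Rightarrow> ennreal"
  assumes J: "finite J" and t: "0 < t" "t \<le> 1"
  shows "sum b J \<le> ennpowr (\<Sum>k\<in>J. ennpowr (b k) t) (1 / t)"
proof (cases "\<exists>k\<in>J. b k = \<top>")
  case True
  then obtain k where "k \<in> J" "b k = \<top>" by blast
  then have "\<top> \<le> (\<Sum>k\<in>J. ennpowr (b k) t)"
    using J member_le_sum[of k J "\<lambda>k. ennpowr (b k) t"] by simp
  then have "(\<Sum>k\<in>J. ennpowr (b k) t) = \<top>" by (simp add: top_unique)
  then show ?thesis by simp
next
  case False
  define r where "r k = enn2real (b k)" for k
  have r: "0 \<le> r k" for k by (simp add: r_def)
  have b: "b k = ennreal (r k)" if "k \<in> J" for k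
    using False that by (simp add: r_def less_top)
  define s where "s = sum r J"
  have "0 \<le> s" unfolding s_def by (intro sum_nonneg r)
  have "s powr t \<le> (\<Sum>k\<in>J. r k powr t)"
  proof (cases "s = 0")
    case False
    then have "0 < s" using \<open>0 \<le> s\<close> by simp
    have "r k / s \<le> (r k / s) powr t" if "k \<in> J" for k
    proof (cases "r k = 0")
      case False
      have "r k \<le> s" unfolding s_def using J that r by (intro member_le_sum) auto
      then have "r k / s \<le> 1" "0 < r k / s" using \<open>0 < s\<close> False r[of k] by auto
      then show ?thesis using powr_mono'[of t 1 "r k / s"] t r[of k] \<open>0 < s\<close> by simp
    qed (use t in simp)
    then have "(\<Sum>k\<in>J. r k / s) \<le> (\<Sum>k\<in>J. (r k / s) powr t)" by (rule sum_mono)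
    moreover have "(\<Sum>k\<in>J. r k / s) = 1"
      using False by (simp add: sum_divide_distrib[symmetric] s_def)
    moreover have "(\<Sum>k\<in>J. (r k / s) powr t) = (\<Sum>k\<in>J. r k powr t) / s powr t"
      using r \<open>0 < s\<close> by (simp add: sum_divide_distrib powr_divide)
    ultimately show ?thesis using \<open>0 < s\<close> by (simp add: field_simps)
  qed (simp add: sum_nonneg)
  then have "(s powr t) powr (1 / t) \<le> (\<Sum>k\<in>J. r k powr t) powr (1 / t)"
    using t by (intro powr_mono2) auto
  then have "s \<le> (\<Sum>k\<in>J. r k powr t) powr (1 / t)"
    using t \<open>0 \<le> s\<close> by (simp add: powr_powr)
  moreover have "sum b J = ennreal s" using r by (simp add: b s_def cong: sum.cong)
  moreover have "(\<Sum>k\<in>J. ennpowr (b k) t) = ennreal (\<Sum>k\<in>J. r k powr t)"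
    using r by (simp add: b ennpowr_ennreal cong: sum.cong)
  ultimately show ?thesis by (simp add: ennpowr_ennreal sum_nonneg ennreal_leI)
qed

lemma infsum_le_ennpowr_infsum:
  fixes b :: "'i \<Rightarrow> ennreal"
  assumes t: "0 < t" "t \<le> 1"
  shows "infsum b UNIV \<le> ennpowr (\<Sum>\<^sub>\<infinity>k\<in>UNIV. ennpowr (b k) t) (1 / t)"
proof (rule infsum_ennreal_le)
  fix J :: "'i set" assume "finite J"
  then have "sum b J \<le> ennpowr (\<Sum>k\<in>J. ennpowr (b k) t) (1 / t)"
    by (rule sum_le_ennpowr_sum[OF _ t])
  also have "\<dots> \<le> ennpowr (\<Sum>\<^sub>\<infinity>k\<in>UNIV. ennpowr (b k) t) (1 / t)"
    using t \<open>finite J\<close> by (intro ennpowr_mono sum_le_infsum_ennreal) auto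
  finally show "sum b J \<le> ennpowr (\<Sum>\<^sub>\<infinity>k\<in>UNIV. ennpowr (b k) t) (1 / t)" .
qed

lemma sum_geometric_le:
  fixes q :: real
  assumes "0 \<le> q" "q < 1" "finite J" shows "sum ((^) q) J \<le> 1 / (1 - q)"
proof -
  have "sum ((^) q) J \<le> (\<Sum>n. q ^ n)"
    using assms by (intro sum_le_suminf) auto
  then show ?thesis using assms by (simp add: suminf_geometric)
qed

text \<open>A geometric sum is dominated by its largest term.\<close>

lemma sum_powr_int_le:
  fixes t c :: real and J :: "int set" and k0 :: int
  assumes t: "0 < t" and J: "finite J" "\<And>k. k \<in> J \<Longrightarrow> k \<le> k0" and "0 \<le> c"
  shows "(\<Sum>k\<in>J. (c * 2 powr k) powr t) \<le> (c * 2 powr k0) powr t / (1 - 2 powr - t)"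
proof -
  define q :: real where "q = 2 powr - t"
  have q: "0 \<le> q" "q < 1" using t by (auto simp: q_def powr_less_one)
  have inj: "inj_on (\<lambda>k. nat (k0 - k)) J"
  proof (rule inj_onI)
    fix x y assume "x \<in> J" "y \<in> J" "nat (k0 - x) = nat (k0 - y)"
    then show "x = y" using J(2)[of x] J(2)[of y] by linarith
  qed
  have "(c * 2 powr k) powr t = (c * 2 powr k0) powr t * q ^ nat (k0 - k)" if "k \<in> J" for k
  proof -
    have "q ^ nat (k0 - k) = 2 powr (- t * (k0 - k))"
      using J(2)[OF that] by (simp add: q_def powr_powr powr_realpow[symmetric])
    then show ?thesis using \<open>0 \<le> c\<close>
      by (simp add: powr_mult powr_powr powr_add[symmetric] algebra_simps)
  qed
  then have "(\<Sum>k\<in>J. (c * 2 powr k) powr t) = (c * 2 powr k0) powr t * (\<Sum>k\<in>J. q ^ nat (k0 - k))"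
    by (simp add: sum_distrib_left)
  also have "(\<Sum>k\<in>J. q ^ nat (k0 - k)) = sum ((^) q) ((\<lambda>k. nat (k0 - k)) ` J)"
    by (simp add: sum.reindex[OF inj])
  also have "\<dots> \<le> 1 / (1 - q)" by (rule sum_geometric_le[OF q]) (use J in simp)
  finally show ?thesis using mult_left_mono by (fastforce simp: q_def)
qed

text \<open>
  A telescoping series over all integers, constant towards \<open>\<infinity>\<close> and decaying geometrically
  towards \<open>-\<infinity>\<close>; the decay makes it converge unconditionally.
\<close>

lemma has_sum_telescope_int:
  fixes s :: "int \<Rightarrow> real"
  assumes lim: "\<And>k. k \<ge> k0 \<Longrightarrow> s k = L" and bound: "\<And>k. \<bar>s k\<bar> \<le> C * 2 powr k"
  shows "((\<lambda>k. s (k + 1) - s k) has_sum L) UNIV"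
proof -
  define h where "h j = s (k0 - int j)" for j
  have hb: "\<bar>h j\<bar> \<le> C * 2 powr k0 * (1/2) ^ j" for j
  proof -
    have "2 powr (real_of_int k0 - real j) = 2 powr k0 * (1/2) ^ j"
      by (simp add: powr_diff powr_realpow power_divide)
    then show ?thesis using bound[of "k0 - int j"] by (simp add: h_def)
  qed
  have g: "summable (\<lambda>j. C * 2 powr k0 * (1/2) ^ j)"
    by (intro summable_mult summable_geometric) simp
  have h0: "h \<longlonglongrightarrow> 0"
    by (rule Lim_null_comparison[OF _ summable_LIMSEQ_zero[OF g]]) (use hb in simp)
  have "summable (\<lambda>j. norm (h j))"
    by (rule summable_comparison_test[OF _ g]) (use hb in auto)
  then have "summable (\<lambda>j. norm (h j) + norm (h (Suc j)))"
    by (intro summable_add summable_Suc_iff[THEN iffD2])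
  then have "summable (\<lambda>j. norm (h j - h (Suc j)))"
    by (rule summable_comparison_test[rotated]) (auto intro!: exI[of _ 0] norm_triangle_ineq4)
  moreover have "(\<lambda>j. h j - h (Suc j)) sums (h 0 - 0)" by (rule telescope_sums'[OF h0])
  moreover have "h 0 = L" by (simp add: h_def lim)
  ultimately have "((\<lambda>j. h j - h (Suc j)) has_sum L) UNIV"
    by (intro norm_summable_imp_has_sum) auto
  moreover have "bij_betw (\<lambda>j. k0 - 1 - int j) UNIV {..k0 - 1}"
    by (rule bij_betwI[where g="\<lambda>k. nat (k0 - 1 - k)"]) auto
  ultimately have "((\<lambda>k. s (k + 1) - s k) has_sum L) {..k0 - 1}"
    by (subst has_sum_reindex_bij_betw[symmetric, where g="\<lambda>j. k0 - 1 - int j"])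
       (auto simp: h_def algebra_simps)
  then show ?thesis
    by (rule has_sum_cong_neutral[THEN iffD1, rotated -1]) (auto simp: lim)
qed

section \<open>Functionals of sequences\<close>

text \<open>The sequence \<open>s\<close> frozen at the time \<open>j\<close>, which may be infinite.\<close>

definition stop_seq :: "enat \<Rightarrow> (nat \<Rightarrow> 'b) \<Rightarrow> nat \<Rightarrow> 'b"
  where "stop_seq j s n = (if enat n \<le> j then s n else s (the_enat j))"

lemma stop_seq_0 [simp]: "stop_seq j s 0 = s 0"
  by (simp add: stop_seq_def zero_enat_def[symmetric])

lemma stop_seq_infinity [simp]: "stop_seq \<infinity> s = s"
  by (simp add: stop_seq_def fun_eq_iff)

lemma stop_seq_eq: "enat n \<le> j \<Longrightarrow> stop_seq j s n = s n"
  by (simp add: stop_seq_def)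

lemma stop_seq_Suc:
  fixes s :: "nat \<Rightarrow> real"
  shows "stop_seq j s (Suc n) = stop_seq j s n + (if enat (Suc n) \<le> j then s (Suc n) - s n else 0)"
proof (cases j)
  case (enat m)
  consider "Suc n \<le> m" | "m = n" | "m < n" by linarith
  then show ?thesis by cases (auto simp: stop_seq_def enat)
qed simp

lemma stop_seq_le:
  assumes "\<And>m. m \<le> n \<Longrightarrow> enat m \<le> j \<Longrightarrow> P (s m)" shows "P (stop_seq j s n)"
proof (cases "enat n \<le> j")
  case False
  then obtain m where "j = enat m" "m < n" by (cases j) auto
  then show ?thesis using assms[of m] by (simp add: stop_seq_def)
qed (simp add: stop_seq_def assms)

text \<open>
  The operators \<^const>\<open>maximal_fun\<close> and \<^const>\<open>square_fun\<close> are suprema over \<open>n\<close> of seminorms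
  \<open>U s n\<close> of the first \<open>n + 1\<close> members of a sequence \<open>s\<close>. These are the pathwise properties
  that both seminorms share; continuity refers to the product topology on sequences.
\<close>

locale seq_seminorm =
  fixes U :: "(nat \<Rightarrow> real) \<Rightarrow> nat \<Rightarrow> real"
  assumes abs_le: "\<bar>s n\<bar> \<le> real (n + 1) * U s n"
    and at_0: "U s 0 = \<bar>s 0\<bar>"
    and triangle: "U (\<lambda>n. s n + s' n) n \<le> U s n + U s' n"
    and scale: "U (\<lambda>n. c * s n) n = \<bar>c\<bar> * U s n"
    and stop: "U (stop_seq j s) n = stop_seq j (U s) n"
    and continuous: "continuous_on UNIV (\<lambda>s. U s n)"
begin

text \<open>The operator on processes that \<open>U\<close> induces pathwise.\<close>

definition fun_of :: "(nat \<Rightarrow> 'a \<Rightarrow> real) \<Rightarrow> 'a \<Rightarrow> ennreal"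
  where "fun_of f x = (SUP n. ennreal (U (\<lambda>j. f j x) n))"

lemma nonneg: "0 \<le> U s n"
proof -
  have "0 \<le> real (n + 1) * U s n" using abs_le[of s n] abs_ge_zero order_trans by blast
  then show ?thesis by (simp add: zero_le_mult_iff)
qed

lemma zero: "U (\<lambda>n. 0) n = 0"
  using scale[of 0 "\<lambda>n. 0" n] by simp

lemma diff: "U (\<lambda>n. s n - s' n) n \<le> U s n + U s' n"
  using triangle[of s "\<lambda>n. (-1) * s' n" n] scale[of "-1" s' n] by simp

lemma sum:
  assumes "finite J" shows "U (\<lambda>n. \<Sum>k\<in>J. h k n) n \<le> (\<Sum>k\<in>J. U (h k) n)"
  using assms
proof (induction J rule: finite_induct)
  case (insert k J)
  then show ?case using triangle[of "h k" "\<lambda>n. \<Sum>k\<in>J. h k n" n] by simp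
qed (simp add: zero)

lemma tendsto:
  assumes "\<And>j. ((\<lambda>i. h i j) \<longlongrightarrow> s j) G" shows "((\<lambda>i. U (h i) n) \<longlongrightarrow> U s n) G"
proof -
  have "limitin (product_topology (\<lambda>j. euclidean) UNIV) h s G"
    using assms by (simp add: limitin_componentwise)
  then have "(h \<longlongrightarrow> s) G" by (simp add: euclidean_product_topology)
  then show ?thesis
    using continuous_on_tendsto_compose[OF continuous[of n], of h s G] by simp
qed

text \<open>Freezing the sequence at \<open>n\<close> shows that only its members up to \<open>n\<close> matter.\<close>

lemma measurable:
  assumes "\<And>j. j \<le> n \<Longrightarrow> f j \<in> borel_measurable N"
  shows "(\<lambda>x. U (\<lambda>j. f j x) n) \<in> borel_measurable N"
proof -
  have "stop_seq (enat n) s = (\<lambda>j. s (min j n))" for s :: "nat \<Rightarrow> real"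
    by (auto simp: stop_seq_def fun_eq_iff min_def)
  then have "U (\<lambda>j. f j x) n = U (\<lambda>j. f (min j n) x) n" for x
    using stop[of "enat n" "\<lambda>j. f j x" n] by (simp add: stop_seq_def)
  moreover have "(\<lambda>x j. f (min j n) x) \<in> borel_measurable N"
    by (rule measurable_coordinatewise_then_product) (auto intro: assms)
  then have "(\<lambda>x. U (\<lambda>j. f (min j n) x) n) \<in> borel_measurable N"
    using measurable_compose borel_measurable_continuous_onI[OF continuous] by blast
  ultimately show ?thesis by simp
qed

lemma U_le_fun_of: "ennreal (U (\<lambda>j. f j x) n) \<le> fun_of f x"
  unfolding fun_of_def by (rule SUP_upper) simp

lemma fun_of_cong: "(\<And>n. f n x = g n x) \<Longrightarrow> fun_of f x = fun_of g x"
  by (simp add: fun_of_def)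

lemma fun_of_scale:
  "fun_of (\<lambda>n x. c * f n x) x = ennreal \<bar>c\<bar> * fun_of f x"
  by (simp add: fun_of_def scale ennreal_mult nonneg SUP_mult_left_ennreal)

lemma fun_of_eq_0: "(\<And>n. f n x = 0) \<Longrightarrow> fun_of f x = 0"
  by (simp add: fun_of_def zero)

lemma fun_of_measurable:
  "(\<And>n. f n \<in> borel_measurable N) \<Longrightarrow> fun_of f \<in> borel_measurable N"
  unfolding fun_of_def
  by (intro borel_measurable_SUP measurable_compose[OF measurable measurable_ennreal]) auto

text \<open>Countable subadditivity, by passing to the limit from finite partial sums.\<close>

lemma fun_of_has_sum:
  fixes h :: "'i \<Rightarrow> nat \<Rightarrow> 'a \<Rightarrow> real"
  assumes "\<And>n. ((\<lambda>k. h k n x) has_sum f n x) UNIV"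
  shows "fun_of f x \<le> (\<Sum>\<^sub>\<infinity>k\<in>UNIV. fun_of (h k) x)"
  unfolding fun_of_def[of f]
proof (rule SUP_least)
  fix n
  let ?S = "\<Sum>\<^sub>\<infinity>k\<in>UNIV. fun_of (h k) x"
  have "((\<lambda>J. U (\<lambda>j. \<Sum>k\<in>J. h k j x) n) \<longlongrightarrow> U (\<lambda>j. f j x) n) (finite_subsets_at_top UNIV)"
    using assms unfolding has_sum_def by (intro tendsto) simp
  then have "((\<lambda>J. ennreal (U (\<lambda>j. \<Sum>k\<in>J. h k j x) n)) \<longlongrightarrow> ennreal (U (\<lambda>j. f j x) n))
      (finite_subsets_at_top UNIV)"
    by (rule tendsto_ennrealI)
  moreover have "\<forall>\<^sub>F J in finite_subsets_at_top UNIV. ennreal (U (\<lambda>j. \<Sum>k\<in>J. h k j x) n) \<le> ?S"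
  proof (rule eventually_finite_subsets_at_top_weakI)
    fix J :: "'i set" assume J: "finite J"
    have "ennreal (U (\<lambda>j. \<Sum>k\<in>J. h k j x) n) \<le> ennreal (\<Sum>k\<in>J. U (\<lambda>j. h k j x) n)"
      by (intro ennreal_leI sum J)
    also have "\<dots> = (\<Sum>k\<in>J. ennreal (U (\<lambda>j. h k j x) n))" by (simp add: nonneg)
    also have "\<dots> \<le> (\<Sum>k\<in>J. fun_of (h k) x)" by (intro sum_mono U_le_fun_of)
    also have "\<dots> \<le> ?S" by (rule sum_le_infsum_ennreal[OF J])
    finally show "ennreal (U (\<lambda>j. \<Sum>k\<in>J. h k j x) n) \<le> ?S" .
  qed
  ultimately show "ennreal (U (\<lambda>j. f j x) n) \<le> ?S"
    by (rule tendsto_upperbound) simp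
qed

text \<open>
  Between two stopping times at which \<open>U\<close> is still at most \<open>c\<close>, the sequence contributes at
  most \<open>2 c\<close>.
\<close>

lemma U_stop_diff_le:
  assumes "i \<le> j" "\<And>n. enat n \<le> j \<Longrightarrow> U s n \<le> c"
  shows "U (\<lambda>n. stop_seq j s n - stop_seq i s n) n \<le> 2 * c"
proof -
  have "U (stop_seq j s) n \<le> c" "U (stop_seq i s) n \<le> c"
    unfolding stop using assms by (auto intro!: stop_seq_le[where P="\<lambda>u. u \<le> c"])
  then show ?thesis using diff[of "stop_seq j s" "stop_seq i s" n] by simp
qed

end

text \<open>The seminorm that induces \<^const>\<open>maximal_fun\<close>.\<close>

definition max_seminorm :: "(nat \<Rightarrow> real) \<Rightarrow> nat \<Rightarrow> real"
  where "max_seminorm s n = \<bar>s n\<bar>"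

text \<open>The differences of a sequence, which is taken to be \<open>0\<close> before the index \<open>0\<close>.\<close>

definition increment :: "(nat \<Rightarrow> real) \<Rightarrow> nat \<Rightarrow> real"
  where "increment s j = (case j of 0 \<Rightarrow> s 0 | Suc i \<Rightarrow> s (Suc i) - s i)"

text \<open>The seminorm that induces \<^const>\<open>square_fun\<close>.\<close>

definition square_seminorm :: "(nat \<Rightarrow> real) \<Rightarrow> nat \<Rightarrow> real"
  where "square_seminorm s n = L2_set (increment s) {..n}"

interpretation max_seminorm: seq_seminorm max_seminorm
proof
  fix s :: "nat \<Rightarrow> real" and n
  show "\<bar>s n\<bar> \<le> real (n + 1) * max_seminorm s n"
    by (simp add: max_seminorm_def algebra_simps)
qed (auto simp: max_seminorm_def stop_seq_def abs_mult intro!: continuous_intros)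

lemma sum_increment: "(\<Sum>j\<le>n. increment s j) = s n"
  by (induction n) (auto simp: increment_def)

lemma sum_increment_stop_seq:
  "(\<Sum>j\<le>n. (increment (stop_seq k s) j)\<^sup>2) = stop_seq k (\<lambda>n. \<Sum>j\<le>n. (increment s j)\<^sup>2) n"
  by (induction n) (auto simp: stop_seq_Suc increment_def)

interpretation square_seminorm: seq_seminorm square_seminorm
proof
  fix s s' :: "nat \<Rightarrow> real" and n and c :: real and j :: enat
  show "\<bar>s n\<bar> \<le> real (n + 1) * square_seminorm s n"
  proof -
    have "\<bar>s n\<bar> \<le> (\<Sum>j\<le>n. \<bar>increment s j\<bar>)"
      using sum_abs[of "increment s" "{..n}"] by (simp add: sum_increment)
    also have "\<dots> \<le> (\<Sum>j\<le>n. square_seminorm s n)"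
      unfolding square_seminorm_def
      by (intro sum_mono) (use member_le_L2_set[of "{..n}" _ "\<lambda>j. \<bar>increment s j\<bar>"] in \<open>simp add: L2_set_def\<close>)
    finally show ?thesis by simp
  qed
  show "square_seminorm s 0 = \<bar>s 0\<bar>"
    by (simp add: square_seminorm_def L2_set_def increment_def)
  show "square_seminorm (\<lambda>n. s n + s' n) n \<le> square_seminorm s n + square_seminorm s' n"
  proof -
    have "increment (\<lambda>n. s n + s' n) = (\<lambda>j. increment s j + increment s' j)"
      by (auto simp: fun_eq_iff increment_def split: nat.split)
    then show ?thesis by (simp add: square_seminorm_def L2_set_triangle_ineq)
  qed
  show "square_seminorm (\<lambda>n. c * s n) n = \<bar>c\<bar> * square_seminorm s n"
  proof -
    have "increment (\<lambda>n. c * s n) = (\<lambda>j. c * increment s j)"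
      by (auto simp: fun_eq_iff increment_def algebra_simps split: nat.split)
    then show ?thesis
      by (simp add: square_seminorm_def L2_set_def power_mult_distrib sum_distrib_left[symmetric]
          real_sqrt_mult)
  qed
  show "square_seminorm (stop_seq j s) n = stop_seq j (square_seminorm s) n"
    unfolding square_seminorm_def L2_set_def sum_increment_stop_seq by (simp add: stop_seq_def)
next
  fix n
  have "continuous_on UNIV (\<lambda>s. increment s j)" for j
    by (cases j) (auto simp: increment_def intro!: continuous_intros)
  then show "continuous_on UNIV (\<lambda>s. square_seminorm s n)"
    unfolding square_seminorm_def L2_set_def by (intro continuous_intros) auto
qed

lemma maximal_fun_eq: "maximal_fun = max_seminorm.fun_of"
  by (simp add: fun_eq_iff maximal_fun_def max_seminorm.fun_of_def max_seminorm_def)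

lemma ennpowr_half_SUP:
  assumes "\<And>n. 0 \<le> r n"
  shows "ennpowr (SUP n. ennreal (r n)) (1/2) = (SUP n. ennreal (sqrt (r n)))"
proof (rule antisym)
  show "(SUP n. ennreal (sqrt (r n))) \<le> ennpowr (SUP n. ennreal (r n)) (1/2)"
  proof (rule SUP_least)
    fix n
    have "ennreal (sqrt (r n)) = ennpowr (ennreal (r n)) (1/2)"
      using assms by (simp add: ennpowr_ennreal powr_half_sqrt)
    also have "\<dots> \<le> ennpowr (SUP n. ennreal (r n)) (1/2)"
      by (intro ennpowr_mono SUP_upper) auto
    finally show "ennreal (sqrt (r n)) \<le> \<dots>" .
  qed
  have "(SUP n. ennreal (r n)) \<le> ennpowr (SUP n. ennreal (sqrt (r n))) 2"
  proof (rule SUP_least)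
    fix n
    have "ennreal (r n) = ennpowr (ennreal (sqrt (r n))) 2"
      using assms[of n] by (simp add: ennpowr_ennreal powr_numeral)
    also have "\<dots> \<le> ennpowr (SUP n. ennreal (sqrt (r n))) 2"
      by (intro ennpowr_mono SUP_upper) auto
    finally show "ennreal (r n) \<le> \<dots>" .
  qed
  then have "ennpowr (SUP n. ennreal (r n)) (1/2) \<le> ennpowr (ennpowr (SUP n. ennreal (sqrt (r n))) 2) (1/2)"
    by (rule ennpowr_mono) simp
  then show "ennpowr (SUP n. ennreal (r n)) (1/2) \<le> (SUP n. ennreal (sqrt (r n)))"
    by (simp add: ennpowr_inverse)
qed

lemma square_fun_eq: "square_fun = square_seminorm.fun_of"
proof (intro ext)
  fix f :: "nat \<Rightarrow> 'a \<Rightarrow> real" and x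
  have inc: "mart_diff f j x = increment (\<lambda>j. f j x) j" for j
    by (cases j) (auto simp: mart_diff_def increment_def)
  have "(\<Sum>n. ennreal (\<bar>mart_diff f n x\<bar>\<^sup>2)) = (SUP n. \<Sum>j<Suc n. ennreal ((increment (\<lambda>j. f j x) j)\<^sup>2))"
    unfolding suminf_eq_SUP inc power2_abs
  proof (rule SUP_eq)
    fix n
    show "\<exists>m\<in>UNIV. (\<Sum>j<n. ennreal ((increment (\<lambda>j. f j x) j)\<^sup>2))
        \<le> (\<Sum>j<Suc m. ennreal ((increment (\<lambda>j. f j x) j)\<^sup>2))"
      by (intro bexI[of _ n] sum_mono2) auto
  qed blast
  also have "\<dots> = (SUP n. ennreal (\<Sum>j\<le>n. (increment (\<lambda>j. f j x) j)\<^sup>2))"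
    by (simp add: lessThan_Suc_atMost)
  finally show "square_fun f x = square_seminorm.fun_of f x"
    by (simp add: square_fun_def square_seminorm.fun_of_def ennpowr_half_SUP sum_nonneg
        square_seminorm_def L2_set_def)
qed

section \<open>Variable exponents\<close>

text \<open>
  The exponent \<open>p\<close> lies almost everywhere in an interval \<open>[q, r]\<close> with \<open>q > 0\<close>; \<open>q\<close> and
  \<open>r\<close> need not be the essential bounds of \<open>p\<close>.
\<close>

locale variable_exponent = prob_space M for M :: "'a measure" +
  fixes p :: "'a \<Rightarrow> real" and q r :: real
  assumes p_measurable [measurable]: "p \<in> borel_measurable M"
    and q_pos: "0 < q"
    and p_bounds: "AE x in M. q \<le> p x \<and> p x \<le> r"
begin

lemma var_norm_mono:
  assumes "AE x in M. f x \<le> g x" shows "var_norm M p f \<le> var_norm M p g"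
  unfolding var_norm_def
proof (rule Inf_superset_mono, clarify)
  fix l :: real
  assume l: "0 < l" and g: "(\<integral>\<^sup>+ x. ennpowr (g x / ennreal l) (p x) \<partial>M) \<le> 1"
  have "(\<integral>\<^sup>+ x. ennpowr (f x / ennreal l) (p x) \<partial>M) \<le> (\<integral>\<^sup>+ x. ennpowr (g x / ennreal l) (p x) \<partial>M)"
    using assms p_bounds q_pos
    by (intro nn_integral_mono_AE) (auto elim!: eventually_elim2 intro!: ennpowr_mono divide_right_mono_ennreal)
  with g l show "\<exists>l'. ennreal l = ennreal l' \<and> 0 < l' \<and>
      (\<integral>\<^sup>+ x. ennpowr (f x / ennreal l') (p x) \<partial>M) \<le> 1"
    by (intro exI[of _ l]) auto
qed

lemma var_norm_le:
  assumes "0 < l" "(\<integral>\<^sup>+ x. ennpowr (f x / ennreal l) (p x) \<partial>M) \<le> 1"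
  shows "var_norm M p f \<le> ennreal l"
  unfolding var_norm_def using assms by (intro Inf_lower) auto

lemma var_norm_indicator_le_1:
  assumes "E \<in> sets M" shows "var_norm M p (indicator E) \<le> 1"
proof -
  have "(\<integral>\<^sup>+ x. ennpowr (indicator E x / ennreal 1) (p x) \<partial>M) \<le> (\<integral>\<^sup>+ x. 1 \<partial>M)"
    by (intro nn_integral_mono) (simp split: split_indicator)
  then show ?thesis using var_norm_le[of 1 "indicator E"] by (simp add: emeasure_space_1)
qed

text \<open>
  If \<open>E\<close> has positive probability, then scales \<open>l\<close> with \<open>l powr q < prob E\<close> are too small to be
  admissible in the norm of its indicator.
\<close>

lemma var_norm_indicator_eq_0:
  assumes E [measurable]: "E \<in> sets M" and "var_norm M p (indicator E) = 0"
  shows "prob E = 0"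
proof (rule ccontr)
  assume "prob E \<noteq> 0"
  then have E0: "0 < prob E" by (simp add: zero_less_measure_iff)
  define \<delta> where "\<delta> = prob E powr (1 / q)"
  have \<delta>: "0 < \<delta>" "\<delta> \<le> 1" using E0 q_pos by (auto simp: \<delta>_def intro: powr_le1)
  have "var_norm M p (indicator E) < ennreal \<delta>" using assms(2) \<delta> by simp
  then obtain l where l: "0 < l" "l < \<delta>"
      and int: "(\<integral>\<^sup>+ x. ennpowr (indicator E x / ennreal l) (p x) \<partial>M) \<le> 1"
    unfolding var_norm_def by (auto simp: Inf_less_iff ennreal_less_iff)
  have "1 < prob E * (1 / l) powr q"
  proof -
    have "l powr q < \<delta> powr q" using l q_pos by (intro powr_less_mono2) auto
    also have "\<delta> powr q = prob E" using q_pos E0 by (simp add: \<delta>_def powr_powr)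
    finally show ?thesis using l by (simp add: powr_divide field_simps)
  qed
  then have "1 < ennreal ((1 / l) powr q) * emeasure M E"
    using E0 by (simp add: emeasure_eq_measure ennreal_mult[symmetric] mult.commute)
  also have "\<dots> = (\<integral>\<^sup>+ x. ennreal ((1 / l) powr q) * indicator E x \<partial>M)"
    by (simp add: nn_integral_cmult_indicator[OF E])
  also have "\<dots> \<le> (\<integral>\<^sup>+ x. ennpowr (indicator E x / ennreal l) (p x) \<partial>M)"
  proof (intro nn_integral_mono_AE, use p_bounds in eventually_elim)
    case (elim x)
    have "(1 / l) powr q \<le> (1 / l) powr p x"
      using elim l \<delta> by (intro powr_mono) auto
    then show ?case using l
      using divide_ennreal[of 1 l]
      by (auto split: split_indicator simp: ennpowr_ennreal intro!: ennreal_leI)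
  qed
  finally show False using int by simp
qed

lemma p_bounds_on:
  assumes Q [measurable]: "Q \<in> sets M" and pos: "0 < prob Q"
  obtains a b where "p_minus M p Q = ereal a" "p_plus M p Q = ereal b" "q \<le> a" "a \<le> b" "b \<le> r"
    "AE x in M. x \<in> Q \<longrightarrow> a \<le> p x \<and> p x \<le> b"
proof -
  let ?N = "restrict_space M Q"
  have AE_iff: "(AE x in ?N. P x) \<longleftrightarrow> (AE x in M. x \<in> Q \<longrightarrow> P x)" for P
    using Q by (subst AE_restrict_space_iff) (auto simp: Int_absorb2 sets.sets_into_space)
  \<comment> \<open>A property that holds almost everywhere on \<open>Q\<close> has a witness, as \<open>Q\<close> is not a null set.\<close>
  have nontrivial: "\<exists>x. P x" if "AE x in M. x \<in> Q \<longrightarrow> P x" for P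
  proof (rule ccontr)
    assume "\<nexists>x. P x"
    then have "AE x in M. x \<notin> Q" using that by simp
    then have "emeasure M Q = 0" using Q AE_iff_null_sets by blast
    then show False using pos by (simp add: measure_def)
  qed
  have [measurable]: "p \<in> borel_measurable ?N"
    by (rule measurable_restrict_space1) simp
  have plus: "AE x in M. x \<in> Q \<longrightarrow> ereal (p x) \<le> p_plus M p Q"
    using esssup_AE[where M="?N" and f="\<lambda>x. ereal (p x)"] by (simp add: AE_iff p_plus_def)
  have minus: "AE x in M. x \<in> Q \<longrightarrow> p_minus M p Q \<le> ereal (p x)"
    using esssup_AE[where M="?N" and f="\<lambda>x. - ereal (p x)"]
    by (simp add: AE_iff p_minus_def essinf_def ereal_uminus_le_reorder[of "esssup _ _"])
  have "AE x in ?N. ereal (p x) \<le> ereal r" using p_bounds by (auto simp: AE_iff)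
  then have r: "p_plus M p Q \<le> ereal r" unfolding p_plus_def by (intro esssup_I) auto
  have "AE x in ?N. - ereal (p x) \<le> - ereal q" using p_bounds by (auto simp: AE_iff)
  then have "esssup ?N (\<lambda>x. - ereal (p x)) \<le> - ereal q" by (intro esssup_I) auto
  then have q: "ereal q \<le> p_minus M p Q"
    unfolding p_minus_def essinf_def by (subst ereal_minus_le_minus[symmetric]) simp
  have *: "AE x in M. x \<in> Q \<longrightarrow> p_minus M p Q \<le> ereal (p x) \<and> ereal (p x) \<le> p_plus M p Q"
    using plus minus by auto
  then obtain x where "p_minus M p Q \<le> ereal (p x)" "ereal (p x) \<le> p_plus M p Q"
    using nontrivial[OF *] by blast
  with q r obtain a b where ab: "p_minus M p Q = ereal a" "p_plus M p Q = ereal b" "a \<le> b"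
    by (cases "p_minus M p Q"; cases "p_plus M p Q") auto
  show ?thesis
    by (rule that[OF ab(1,2) _ ab(3)]) (use q r plus minus ab in auto)
qed

text \<open>
  If \<open>A\<close> fills a fixed proportion of \<open>Q\<close> and some \<open>g\<close> in the unit ball of the variable
  Lebesgue space is at least \<open>c\<close> on \<open>A\<close>, then the integrals of \<open>c\<close> to the power \<open>p\<close> over
  \<open>Q\<close> and over \<open>A\<close> are comparable. With \<open>a\<close> and \<open>b\<close> the essential bounds of \<open>p\<close> on \<open>Q\<close>, the
  function \<open>g\<close> forces the power \<open>a\<close> of \<open>c\<close> to be at most \<open>R / prob Q\<close>, so that passing from \<open>a\<close>
  to \<open>b\<close> costs a bounded factor by the hypothesis on \<open>prob Q\<close>.
\<close>

lemma integral_const_powr_le: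
  assumes meas [measurable]: "Q \<in> sets M" "A \<in> sets M" and "A \<subseteq> Q"
    and QA: "prob Q \<le> R * prob A" and R: "1 \<le> R" and K: "1 \<le> K"
    and osc: "prob Q powr real_of_ereal (p_minus M p Q - p_plus M p Q) \<le> K"
    and c: "1 \<le> c" and g: "\<And>x. x \<in> A \<Longrightarrow> ennreal c \<le> g x"
    and int_g: "(\<integral>\<^sup>+ x. ennpowr (g x) (p x) \<partial>M) \<le> 1"
  shows "(\<integral>\<^sup>+ x. ennreal (c powr p x) * indicator Q x \<partial>M)
    \<le> ennreal (R * (R powr (r / q) * K powr (1 / q))) * (\<integral>\<^sup>+ x. ennreal (c powr p x) * indicator A x \<partial>M)"
proof (cases "prob Q = 0")
  case True
  then have "AE x in M. x \<notin> Q"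
    using meas by (intro AE_not_in) (auto simp: emeasure_eq_measure)
  then have "(\<integral>\<^sup>+ x. ennreal (c powr p x) * indicator Q x \<partial>M) = (\<integral>\<^sup>+ x. 0 \<partial>M)"
    by (intro nn_integral_cong_AE) (auto split: split_indicator)
  then show ?thesis by simp
next
  case False
  then have Q0: "0 < prob Q" by (simp add: zero_less_measure_iff)
  obtain a b where ab: "p_minus M p Q = ereal a" "p_plus M p Q = ereal b" "q \<le> a" "a \<le> b" "b \<le> r"
      "AE x in M. x \<in> Q \<longrightarrow> a \<le> p x \<and> p x \<le> b"
    using p_bounds_on[OF meas(1) Q0] .
  have a0: "0 < a" using ab q_pos by simp
  have lower: "ennreal (c powr a * prob A) \<le> (\<integral>\<^sup>+ x. ennreal (c powr p x) * indicator A x \<partial>M)"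
  proof -
    have "ennreal (c powr a * prob A) = (\<integral>\<^sup>+ x. ennreal (c powr a) * indicator A x \<partial>M)"
      by (simp add: nn_integral_cmult_indicator[OF meas(2)] emeasure_eq_measure ennreal_mult)
    also have "\<dots> \<le> (\<integral>\<^sup>+ x. ennreal (c powr p x) * indicator A x \<partial>M)"
      using ab(6) by (intro nn_integral_mono_AE)
        (auto elim!: eventually_mono split: split_indicator intro!: ennreal_leI powr_mono dest: subsetD[OF \<open>A \<subseteq> Q\<close>] simp: c)
    finally show ?thesis .
  qed
  have "(\<integral>\<^sup>+ x. ennreal (c powr p x) * indicator A x \<partial>M) \<le> (\<integral>\<^sup>+ x. ennpowr (g x) (p x) \<partial>M)"
  proof (intro nn_integral_mono_AE, use p_bounds in eventually_elim)
    case (elim x)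
    have "ennreal (c powr p x) \<le> ennpowr (g x) (p x)" if "x \<in> A"
    proof -
      have "ennreal (c powr p x) = ennpowr (ennreal c) (p x)" using c by (simp add: ennpowr_ennreal)
      also have "\<dots> \<le> ennpowr (g x) (p x)"
        using elim q_pos by (intro ennpowr_mono g that) auto
      finally show ?thesis .
    qed
    then show ?case by (simp split: split_indicator)
  qed
  then have "ennreal (c powr a * prob A) \<le> ennreal 1"
    unfolding ennreal_1 by (rule order_trans[OF lower order_trans[OF _ int_g]])
  then have cA: "c powr a * prob A \<le> 1" by (subst (asm) ennreal_le_iff) auto
  have "c powr a * prob Q \<le> R"
  proof -
    have "c powr a * prob Q \<le> c powr a * (R * prob A)" using QA by (intro mult_left_mono) auto
    also have "\<dots> = R * (c powr a * prob A)" by simp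
    also have "\<dots> \<le> R * 1" using cA R by (intro mult_left_mono) auto
    finally show ?thesis by simp
  qed
  then have "c powr a \<le> R / prob Q" using Q0 by (simp add: field_simps)
  then have "(c powr a) powr ((b - a) / a) \<le> (R / prob Q) powr ((b - a) / a)"
    using a0 ab by (intro powr_mono2) auto
  also have "\<dots> = R powr ((b - a) / a) * (prob Q powr (a - b)) powr (1 / a)"
  proof -
    have "(a - b) * (1 / a) = - ((b - a) / a)" using a0 by (simp add: field_simps)
    then have "(prob Q powr (a - b)) powr (1 / a) = prob Q powr - ((b - a) / a)"
      by (simp only: powr_powr)
    then show ?thesis using R Q0 by (simp add: powr_divide powr_minus_divide)
  qed
  also have "\<dots> \<le> R powr (r / q) * K powr (1 / q)"
  proof (intro mult_mono)
    show "R powr ((b - a) / a) \<le> R powr (r / q)"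
      using R a0 ab q_pos by (intro powr_mono frac_le) auto
    have "(prob Q powr (a - b)) powr (1 / a) \<le> K powr (1 / a)"
      using osc ab a0 by (intro powr_mono2) auto
    also have "\<dots> \<le> K powr (1 / q)" using K ab q_pos by (intro powr_mono divide_left_mono) auto
    finally show "(prob Q powr (a - b)) powr (1 / a) \<le> K powr (1 / q)" .
  qed auto
  \<comment> \<open>Passing from the exponent \<open>a\<close> to \<open>b\<close> costs at most this factor.\<close>
  finally have gap: "c powr (b - a) \<le> R powr (r / q) * K powr (1 / q)"
    using a0 by (simp add: powr_powr)
  have "(\<integral>\<^sup>+ x. ennreal (c powr p x) * indicator Q x \<partial>M) \<le> (\<integral>\<^sup>+ x. ennreal (c powr b) * indicator Q x \<partial>M)"
    using ab(6) by (intro nn_integral_mono_AE)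
      (auto elim!: eventually_mono split: split_indicator intro!: ennreal_leI powr_mono simp: c)
  also have "\<dots> = ennreal (c powr b * prob Q)"
    by (simp add: nn_integral_cmult_indicator[OF meas(1)] emeasure_eq_measure ennreal_mult)
  also have "c powr b * prob Q \<le> (R * (R powr (r / q) * K powr (1 / q))) * (c powr a * prob A)"
  proof -
    have "c powr b * prob Q = c powr (b - a) * (c powr a * prob Q)"
      using c by (simp add: powr_add[symmetric])
    also have "\<dots> \<le> (R powr (r / q) * K powr (1 / q)) * (c powr a * (R * prob A))"
      using gap QA by (intro mult_mono) auto
    finally show ?thesis by (simp add: mult_ac)
  qed
  then have "ennreal (c powr b * prob Q)
      \<le> ennreal (R * (R powr (r / q) * K powr (1 / q))) * ennreal (c powr a * prob A)"
    using R by (subst ennreal_mult[symmetric]) (auto intro: ennreal_leI)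
  also have "\<dots> \<le> ennreal (R * (R powr (r / q) * K powr (1 / q))) * (\<integral>\<^sup>+ x. ennreal (c powr p x) * indicator A x \<partial>M)"
    by (intro mult_left_mono lower) simp
  finally show ?thesis .
qed

text \<open>
  At a point \<open>x\<close> only the levels \<open>2 ^ k < g x\<close> contribute, and their \<open>p x\<close>-th powers form a
  geometric sum dominated by that of \<open>g x\<close>.
\<close>

lemma integral_layers_le:
  assumes g [measurable]: "g \<in> borel_measurable M"
    and int_g: "(\<integral>\<^sup>+ x. ennpowr (g x) (p x) \<partial>M) \<le> 1"
  shows "(\<Sum>k. \<integral>\<^sup>+ x. ennreal ((2 ^ k) powr p x) * indicator {x \<in> space M. ennreal (2 ^ k) < g x} x \<partial>M)
    \<le> ennreal (1 / (1 - 2 powr - q))"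
proof -
  let ?C = "1 / (1 - 2 powr - q)"
  have C: "0 < ?C" using q_pos by (simp add: powr_less_one)
  have pt: "(\<Sum>k. ennreal ((2 ^ k) powr p x) * indicator {x \<in> space M. ennreal (2 ^ k) < g x} x)
      \<le> ennreal ?C * ennpowr (g x) (p x)" (is "suminf ?a \<le> _") if px: "q \<le> p x" for x
  proof (cases "g x")
    case (real y)
    let ?d = "\<lambda>k. ennreal ((2 ^ k) powr p x) * indicator {x \<in> space M. ennreal (2 ^ k) < g x} x"
    have "(\<Sum>k<n. ?d k) \<le> ennreal (?C * y powr p x)" for n
    proof -
      let ?J = "{k. k < n \<and> 2 ^ k < y}"
      have "(\<Sum>k<n. ?d k) \<le> (\<Sum>k<n. if 2 ^ k < y then ennreal ((2 ^ k) powr p x) else 0)"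
        using real by (intro sum_mono) (auto split: split_indicator simp: ennreal_less_iff)
      also have "\<dots> = (\<Sum>k\<in>?J. ennreal ((2 ^ k) powr p x))"
        by (simp add: sum.If_cases Int_def)
      also have "\<dots> = ennreal (\<Sum>k\<in>?J. (2 ^ k) powr p x)" by simp
      also have "(\<Sum>k\<in>?J. (2 ^ k) powr p x) \<le> ?C * y powr p x"
      proof (cases "?J = {}")
        case True
        then show ?thesis unfolding True using C by simp
      next
        case False
        define m where "m = Max ?J"
        have J: "finite ?J" by simp
        have m: "2 ^ m < y" "\<And>k. k \<in> ?J \<Longrightarrow> k \<le> m"
          using Max_in[OF J False] Max_ge[OF J] by (auto simp: m_def)
        have "(\<Sum>k\<in>?J. (2 ^ k) powr p x) = (\<Sum>k\<in>int ` ?J. (1 * 2 powr k) powr p x)"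
          by (subst sum.reindex) (auto simp: powr_realpow)
        also have "\<dots> \<le> (1 * 2 powr int m) powr p x / (1 - 2 powr - p x)"
          using px q_pos m by (intro sum_powr_int_le) auto
        also have "\<dots> \<le> y powr p x / (1 - 2 powr - q)"
          using px q_pos m by (intro frac_le powr_mono2) (auto simp: powr_realpow powr_less_one)
        finally show ?thesis by simp
      qed
      then have "ennreal (\<Sum>k\<in>?J. (2 ^ k) powr p x) \<le> ennreal (?C * y powr p x)" by (rule ennreal_leI)
      finally show ?thesis .
    qed
    then have "suminf ?d \<le> ennreal (?C * y powr p x)" by (intro suminf_le_const) auto
    also have "ennreal (?C * y powr p x) = ennreal ?C * ennpowr (g x) (p x)"
      using real C by (simp only: ennpowr_ennreal) (rule ennreal_mult, auto)
    finally show ?thesis .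
  next
    case top
    have "ennreal ?C \<noteq> 0" using C by (simp only: ennreal_eq_0_iff not_le)
    then show ?thesis using top by (simp only: ennpowr_top ennreal_mult_top top_greatest if_False)
  qed
  have "(\<Sum>k. \<integral>\<^sup>+ x. ennreal ((2 ^ k) powr p x) * indicator {x \<in> space M. ennreal (2 ^ k) < g x} x \<partial>M)
      = (\<integral>\<^sup>+ x. (\<Sum>k. ennreal ((2 ^ k) powr p x) * indicator {x \<in> space M. ennreal (2 ^ k) < g x} x) \<partial>M)"
    by (subst nn_integral_suminf) auto
  also have "\<dots> \<le> (\<integral>\<^sup>+ x. ennreal ?C * ennpowr (g x) (p x) \<partial>M)"
    using p_bounds by (intro nn_integral_mono_AE) (auto elim!: eventually_mono intro!: pt)
  also have "\<dots> = ennreal ?C * (\<integral>\<^sup>+ x. ennpowr (g x) (p x) \<partial>M)"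
    by (rule nn_integral_cmult) simp
  also have "\<dots> \<le> ennreal ?C * 1" by (intro mult_left_mono int_g) simp
  finally show ?thesis by simp
qed

end

section \<open>Atoms, covers and hitting times\<close>

lemma atom_of_empty: "atom_of M G {}"
  by (auto simp: atom_of_def)

lemma atom_of_subset:
  assumes "subalgebra M G" "finite_measure M" "atom_of M G B" "A \<subseteq> B" "A \<in> sets G"
  shows "atom_of M G A"
proof -
  interpret finite_measure M by fact
  have sets: "sets G \<subseteq> sets M" using assms(1) by (simp add: subalgebra_def)
  have "measure M A \<le> measure M B"
    using assms sets by (intro finite_measure_mono) (auto simp: atom_of_def)
  then show ?thesis using assms by (fastforce simp: atom_of_def)
qed

lemma atom_of_Int:
  assumes "subalgebra M G" "finite_measure M" "atom_of M G B" "E \<in> sets G"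
  shows "measure M (E \<inter> B) = 0 \<or> measure M (E \<inter> B) = measure M B"
proof -
  interpret finite_measure M by fact
  have sets: "sets G \<subseteq> sets M" using assms(1) by (simp add: subalgebra_def)
  have "measure M (E \<inter> B) \<le> measure M B"
    using assms sets by (intro finite_measure_mono) (auto simp: atom_of_def)
  moreover have "E \<inter> B \<in> sets G" using assms by (auto simp: atom_of_def)
  ultimately show ?thesis using assms(3) by (fastforce simp: atom_of_def)
qed

text \<open>
  What the generating atoms leave over is not split by the \<open>\<sigma>\<close>-algebra, so it is an atom as
  well, and making the countably many atoms disjoint yields a partition of the space.
\<close>

lemma atom_partition:
  assumes sub: "subalgebra M G" and fin: "finite_measure M"
    and gen: "generated_by_countably_many_atoms M G"
  obtains D :: "nat \<Rightarrow> 'a set" where "\<And>i. atom_of M G (D i)" "disjoint_family D" "(\<Union>i. D i) = space M"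
proof -
  obtain C where C: "countable C" "\<And>B. B \<in> C \<Longrightarrow> atom_of M G B" "sets G = sigma_sets (space M) C"
    using gen by (auto simp: generated_by_countably_many_atoms_def)
  have CG: "B \<in> sets G" if "B \<in> C" for B using C(2)[OF that] by (simp add: atom_of_def)
  have space: "space G = space M" using sub by (simp add: subalgebra_def)
  define Z where "Z = space M - \<Union>C"
  have split: "Z \<subseteq> A \<or> Z \<inter> A = {}" if "A \<in> sigma_sets (space M) C" for A
    using that
  proof induction
    case (Union a)
    then show ?case by (cases "\<exists>i. Z \<subseteq> a i") (blast, fast)
  qed (auto simp: Z_def)
  have "\<Union>C \<in> sets G" using CG C(1) by (intro sets.countable_Union) auto
  then have ZG: "Z \<in> sets G" unfolding Z_def using sets.compl_sets[of "\<Union>C" G] space by simp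
  have Z: "atom_of M G Z"
  proof (unfold atom_of_def, intro conjI ballI impI ZG)
    fix A assume "A \<in> sets G" "A \<subseteq> Z \<and> measure M A < measure M Z"
    then show "measure M A = 0" using split[of A] C(3) by (metis Int_absorb1 less_irrefl measure_empty subset_antisym)
  qed
  define E where "E i = (case i of 0 \<Rightarrow> Z | Suc n \<Rightarrow> from_nat_into (insert {} C) n)" for i
  have E: "atom_of M G (E i)" for i
  proof (cases i)
    case (Suc n)
    have "from_nat_into (insert {} C) n \<in> insert {} C" by (rule from_nat_into) simp
    then show ?thesis using Suc C(2) atom_of_empty by (auto simp: E_def)
  qed (simp add: E_def Z)
  then have EG: "range E \<subseteq> sets G" by (auto simp: atom_of_def)
  have UN: "(\<Union>i. E i) = space M"
  proof
    show "(\<Union>i. E i) \<subseteq> space M" using EG sets.sets_into_space space by blast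
    show "space M \<subseteq> (\<Union>i. E i)"
    proof
      fix x assume "x \<in> space M"
      then consider "x \<in> Z" | B where "x \<in> B" "B \<in> C" by (auto simp: Z_def)
      then show "x \<in> (\<Union>i. E i)"
      proof cases
        case 1
        then show ?thesis by (intro UN_I[of 0]) (auto simp: E_def)
      next
        case 2
        then have "B \<in> range (from_nat_into (insert {} C))"
          using C(1) by (subst range_from_nat_into) auto
        then obtain n where "B = from_nat_into (insert {} C) n" by auto
        then show ?thesis using 2 by (intro UN_I[of "Suc n"]) (auto simp: E_def)
      qed
    qed
  qed
  show ?thesis
  proof (rule that[of "disjointed E"])
    have "disjointed E i \<in> sets G" for i
      using sets.range_disjointed_sets[OF EG] by auto
    then show "atom_of M G (disjointed E i)" for i
      by (rule atom_of_subset[OF sub fin E disjointed_subset])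
  qed (simp_all add: disjoint_family_disjointed UN_disjointed_eq UN)
qed

text \<open>The first index \<open>n\<close> with \<open>x \<in> B n\<close>.\<close>

definition hitting_time :: "(nat \<Rightarrow> 'a set) \<Rightarrow> 'a \<Rightarrow> enat"
  where "hitting_time B x = (if \<exists>n. x \<in> B n then enat (LEAST n. x \<in> B n) else \<infinity>)"

lemma hitting_time_le_iff: "hitting_time B x \<le> enat n \<longleftrightarrow> (\<exists>m\<le>n. x \<in> B m)"
proof (cases "\<exists>n. x \<in> B n")
  case True
  then show ?thesis
    by (auto simp: hitting_time_def intro: LeastI Least_le order_trans)
qed (auto simp: hitting_time_def)

lemma hitting_time_eqD: "hitting_time B x = enat n \<Longrightarrow> x \<in> B n"
  by (auto simp: hitting_time_def intro: LeastI split: if_splits)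

lemma hitting_time_antimono:
  assumes "\<And>n. B n \<subseteq> B' n" shows "hitting_time B' x \<le> hitting_time B x"
proof (cases "hitting_time B x")
  case (enat n)
  then show ?thesis using hitting_time_le_iff[of B' x n] hitting_time_le_iff[of B x n] assms by auto
qed simp

text \<open>
  A probability space with a filtration; as in \<^const>\<open>martingale\<close>, probabilities are taken in \<open>M\<close>.
\<close>

locale filtered_prob_space = prob_space M for M :: "'a measure" +
  fixes F :: "nat \<Rightarrow> 'a measure"
  assumes subalg: "subalgebra M (F n)"
    and F_mono: "m \<le> n \<Longrightarrow> sets (F m) \<subseteq> sets (F n)"
begin

lemma space_F: "space (F n) = space M"
  using subalg by (simp add: subalgebra_def)

lemma sets_F: "A \<in> sets (F n) \<Longrightarrow> A \<in> sets M"
  using subalg by (auto simp: subalgebra_def)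

lemma measurable_F: "f \<in> borel_measurable (F n) \<Longrightarrow> f \<in> borel_measurable M"
  by (rule measurable_from_subalg[OF subalg])

lemma measurable_F_mono:
  assumes "f \<in> borel_measurable (F m)" "m \<le> n" shows "f \<in> borel_measurable (F n)"
proof -
  have "subalgebra (F n) (F m)" using F_mono[OF assms(2)] by (simp add: subalgebra_def space_F)
  then show ?thesis using assms(1) by (rule measurable_from_subalg)
qed

lemma stopping_time_ext_iff:
  "stopping_time_ext M F \<tau> \<longleftrightarrow> (\<forall>n. {x \<in> space M. \<tau> x \<le> enat n} \<in> sets (F n))"
proof
  assume "stopping_time_ext M F \<tau>"
  then show "\<forall>n. {x \<in> space M. \<tau> x \<le> enat n} \<in> sets (F n)"
    by (auto simp: stopping_time_ext_def stopping_time_def pred_def space_F dest: spec[of _ "enat _"])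
next
  assume *: "\<forall>n. {x \<in> space M. \<tau> x \<le> enat n} \<in> sets (F n)"
  show "stopping_time_ext M F \<tau>"
    unfolding stopping_time_ext_def
  proof
    fix j :: enat
    show "Measurable.pred (case j of enat n \<Rightarrow> F n | \<infinity> \<Rightarrow> M) (\<lambda>x. \<tau> x \<le> j)"
      using * by (cases j) (auto simp: pred_def space_F)
  qed
qed

lemma stopping_time_ext_hitting_time:
  assumes "\<And>n. B n \<in> sets (F n)" shows "stopping_time_ext M F (hitting_time B)"
proof -
  have "{x \<in> space M. hitting_time B x \<le> enat n} = (\<Union>m\<le>n. B m)" for n
    using assms sets_F sets.sets_into_space unfolding hitting_time_le_iff by blast
  moreover have "(\<Union>m\<le>n. B m) \<in> sets (F n)" for n
    using assms F_mono by (intro sets.finite_UN) auto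
  ultimately show ?thesis by (simp add: stopping_time_ext_iff)
qed

lemma stopping_time_ext_ge:
  assumes "stopping_time_ext M F \<tau>" shows "{x \<in> space M. enat (Suc n) \<le> \<tau> x} \<in> sets (F n)"
proof -
  have "enat (Suc n) \<le> \<tau> x \<longleftrightarrow> \<not> \<tau> x \<le> enat n" for x
    by (cases "\<tau> x") auto
  then have "{x \<in> space M. enat (Suc n) \<le> \<tau> x} = space (F n) - {x \<in> space M. \<tau> x \<le> enat n}"
    by (auto simp: space_F)
  then show ?thesis using assms by (auto simp: stopping_time_ext_iff)
qed

lemma stopping_time_ext_eq:
  assumes "stopping_time_ext M F \<tau>" shows "{x \<in> space M. \<tau> x = enat n} \<in> sets (F n)"
proof (cases n)
  case 0
  then have "{x \<in> space M. \<tau> x = enat n} = {x \<in> space M. \<tau> x \<le> enat n}"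
    by (auto simp: zero_enat_def[symmetric])
  then show ?thesis using assms by (simp add: stopping_time_ext_iff)
next
  case (Suc m)
  have "{x \<in> space M. \<tau> x = enat n} = {x \<in> space M. \<tau> x \<le> enat n} \<inter> {x \<in> space M. enat (Suc m) \<le> \<tau> x}"
    by (auto simp: Suc)
  moreover have "{x \<in> space M. enat (Suc m) \<le> \<tau> x} \<in> sets (F n)"
    using stopping_time_ext_ge[OF assms, of m] F_mono[of m n] Suc by auto
  ultimately show ?thesis using assms by (auto simp: stopping_time_ext_iff)
qed

lemma stopping_time_ext_finite_sets:
  assumes "stopping_time_ext M F \<tau>" shows "{x \<in> space M. \<tau> x < \<infinity>} \<in> sets M"
proof -
  have "{x \<in> space M. \<tau> x < \<infinity>} = (\<Union>n. {x \<in> space M. \<tau> x = enat n})"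
    by (auto simp: less_infinityE)
  also have "\<dots> \<in> sets M" using stopping_time_ext_eq[OF assms] sets_F by blast
  finally show ?thesis .
qed

end

text \<open>
  A regular filtration with a partition \<open>D n\<close> of the space into atoms of \<open>F n\<close>, and an exponent
  whose oscillation on atoms is controlled by their probability.
\<close>

locale regular_atomic_filtration =
  filtered_prob_space M F + variable_exponent M p q r
  for M :: "'a measure" and F p q r +
  fixes D :: "nat \<Rightarrow> nat \<Rightarrow> 'a set" and R K :: real
  assumes D_atom: "atom_of M (F n) (D n i)"
    and D_disjoint: "disjoint_family (D n)"
    and D_UN: "(\<Union>i. D n i) = space M"
    and R: "1 \<le> R"
    and regular: "A \<in> sets (F (Suc n)) \<Longrightarrow> \<exists>B\<in>sets (F n). A \<subseteq> B \<and> prob B \<le> R * prob A"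
    and K: "1 \<le> K"
    and oscillation: "atom_of M (F n) A \<Longrightarrow>
      prob A powr real_of_ereal (p_minus M p A - p_plus M p A) \<le> K"
begin

lemma D_sets: "D n i \<in> sets (F n)"
  using D_atom by (simp add: atom_of_def)

text \<open>
  Up to null sets, the smallest set in \<open>F n\<close> that contains \<open>A\<close>. Defined as a union of atoms, it
  is monotone in \<open>A\<close> everywhere and not only almost everywhere.
\<close>

definition cover :: "nat \<Rightarrow> 'a set \<Rightarrow> 'a set"
  where "cover n A = (\<Union>i\<in>{i. 0 < prob (D n i \<inter> A)}. D n i)"

lemma cover_sets: "cover n A \<in> sets (F n)"
  unfolding cover_def by (intro sets.countable_UN') (auto simp: D_sets)

lemma cover_mono:
  assumes "A \<subseteq> B" "B \<in> sets M" shows "cover n A \<subseteq> cover n B"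
proof -
  have "prob (D n i \<inter> A) \<le> prob (D n i \<inter> B)" for i
    using assms sets_F[OF D_sets] by (intro finite_measure_mono) auto
  then show ?thesis unfolding cover_def by (force intro: less_le_trans)
qed

lemma AE_cover:
  assumes "A \<in> sets M" shows "AE x in M. x \<in> A \<longrightarrow> x \<in> cover n A"
proof -
  have "AE x in M. x \<notin> D n i \<inter> A" if "\<not> 0 < prob (D n i \<inter> A)" for i
    using that assms sets_F[OF D_sets, of n i]
    by (intro AE_not_in) (auto simp: emeasure_eq_measure zero_less_measure_iff)
  then have "AE x in M. \<forall>i. \<not> 0 < prob (D n i \<inter> A) \<longrightarrow> x \<notin> D n i \<inter> A"
    by (simp add: AE_all_countable)
  moreover have "AE x in M. x \<in> (\<Union>i. D n i)" by (simp add: D_UN)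
  ultimately show ?thesis by eventually_elim (auto simp: cover_def)
qed

text \<open>
  By regularity \<open>A\<close> fills a proportion of at least \<open>1 / R\<close> of every atom that it meets in positive
  probability.
\<close>

lemma prob_le_prob_Int_cover:
  assumes E: "E \<in> sets (F n)" "E \<subseteq> cover n A" and A: "A \<in> sets (F (Suc n))"
  shows "prob (E \<inter> D n i) \<le> R * prob (E \<inter> D n i \<inter> A)"
proof (cases "prob (E \<inter> D n i) = 0")
  case True
  then show ?thesis using R by simp
next
  case False
  have [measurable]: "E \<in> sets M" "A \<in> sets M" "D n i \<in> sets M"
    using E(1) A sets_F D_sets by auto
  have Q: "prob (E \<inter> D n i) = prob (D n i)"
    using atom_of_Int[OF subalg finite_measure_axioms D_atom E(1)] False by auto
  have "E \<inter> D n i \<noteq> {}" using False by auto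
  then obtain x where x: "x \<in> E" "x \<in> D n i" by auto
  then obtain j where j: "x \<in> D n j" "0 < prob (D n j \<inter> A)" using E(2) by (auto simp: cover_def)
  have "j = i" using j(1) x(2) D_disjoint[of n] by (auto simp: disjoint_family_on_def)
  have "D n i \<in> sets (F (Suc n))" using D_sets F_mono[of n "Suc n"] by auto
  then obtain B where B: "B \<in> sets (F n)" "D n i \<inter> A \<subseteq> B" "prob B \<le> R * prob (D n i \<inter> A)"
    using regular[of "D n i \<inter> A" n] A by auto
  have [measurable]: "B \<in> sets M" using B(1) by (rule sets_F)
  have "prob (D n i \<inter> A) \<le> prob (B \<inter> D n i)" using B(2) by (intro finite_measure_mono) auto
  then have "prob (B \<inter> D n i) = prob (D n i)"
    using atom_of_Int[OF subalg finite_measure_axioms D_atom B(1), of i] j(2) \<open>j = i\<close> by auto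
  moreover have "prob (B \<inter> D n i) \<le> prob B" by (intro finite_measure_mono) auto
  moreover have "prob (D n i \<inter> A) \<le> prob (E \<inter> D n i \<inter> A)"
  proof -
    have "prob (D n i \<inter> A) \<le> prob ((E \<inter> D n i \<inter> A) \<union> (D n i - E \<inter> D n i))"
      by (intro finite_measure_mono) auto
    also have "\<dots> \<le> prob (E \<inter> D n i \<inter> A) + prob (D n i - E \<inter> D n i)"
      by (intro measure_Un_le) auto
    also have "prob (D n i - E \<inter> D n i) = 0"
      using Q by (subst finite_measure_Diff) auto
    finally show ?thesis by simp
  qed
  then have "R * prob (D n i \<inter> A) \<le> R * prob (E \<inter> D n i \<inter> A)" using R by simp
  ultimately show ?thesis using B(3) Q by simp
qed

text \<open>The constant of \<open>integral_const_powr_le\<close>.\<close>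

definition stopping_const :: real
  where "stopping_const = R * (R powr (r / q) * K powr (1 / q))"

text \<open>
  With \<open>\<tau>\<close> the hitting time, the event \<open>\<tau> = n\<close> lies in the cover of \<open>A n\<close>, so that \<open>A n\<close> fills each
  non-null atom of \<open>F n\<close> in this event at least to the proportion \<open>1 / R\<close>. The estimate on these
  atoms is summed over all of them.
\<close>

lemma integral_hitting_time_cover_le:
  assumes A: "\<And>n. A n \<in> sets (F (Suc n))"
    and c: "1 \<le> c" and Ag: "\<And>n x. x \<in> A n \<Longrightarrow> ennreal c < g x"
    and g [measurable]: "g \<in> borel_measurable M"
    and int_g: "(\<integral>\<^sup>+ x. ennpowr (g x) (p x) \<partial>M) \<le> 1"
  shows "(\<integral>\<^sup>+ x. ennreal (c powr p x) * finite_ind M (hitting_time (\<lambda>n. cover n (A n))) x \<partial>M)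
    \<le> ennreal stopping_const *
      (\<integral>\<^sup>+ x. ennreal (c powr p x) * indicator {x \<in> space M. ennreal c < g x} x \<partial>M)"
proof -
  define \<tau> where "\<tau> = hitting_time (\<lambda>n. cover n (A n))"
  define \<nu> where "\<nu> = density M (\<lambda>x. ennreal (c powr p x))"
  define Q where "Q m = (case prod_decode m of (n, i) \<Rightarrow> {x \<in> space M. \<tau> x = enat n} \<inter> D n i)" for m
  define G where "G = {x \<in> space M. ennreal c < g x}"
  have \<nu>: "emeasure \<nu> E = (\<integral>\<^sup>+ x. ennreal (c powr p x) * indicator E x \<partial>M)" if "E \<in> sets M" for E
    unfolding \<nu>_def using that by (intro emeasure_density) auto
  have sets_\<nu>: "sets \<nu> = sets M" by (simp add: \<nu>_def)
  have \<tau>: "stopping_time_ext M F \<tau>"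
    unfolding \<tau>_def by (intro stopping_time_ext_hitting_time cover_sets)
  have G [measurable]: "G \<in> sets M" unfolding G_def by measurable
  have Q [measurable]: "Q m \<in> sets M" for m
  proof -
    obtain n i where m: "prod_decode m = (n, i)" by fastforce
    show ?thesis unfolding Q_def m prod.case
      by (intro sets.Int sets_F[OF stopping_time_ext_eq[OF \<tau>]] sets_F[OF D_sets])
  qed
  have disj: "disjoint_family Q"
  proof (unfold disjoint_family_on_def, intro ballI impI)
    fix m m' :: nat assume "m \<noteq> m'"
    obtain n i where mm: "prod_decode m = (n, i)" by fastforce
    obtain n' i' where mm': "prod_decode m' = (n', i')" by fastforce
    have "(n, i) \<noteq> (n', i')" using \<open>m \<noteq> m'\<close> mm mm' by (metis prod_decode_inverse)
    then have "n \<noteq> n' \<or> D n i \<inter> D n' i' = {}"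
      using D_disjoint[of n] by (auto simp only: disjoint_family_on_def)
    then show "Q m \<inter> Q m' = {}"
      by (auto simp: Q_def mm mm')
  qed
  have UN: "(\<Union>m. Q m) = {x \<in> space M. \<tau> x < \<infinity>}"
  proof
    show "{x \<in> space M. \<tau> x < \<infinity>} \<subseteq> (\<Union>m. Q m)"
    proof
      fix x assume "x \<in> {x \<in> space M. \<tau> x < \<infinity>}"
      then obtain n where n: "x \<in> space M" "\<tau> x = enat n" by auto
      then obtain i where "x \<in> D n i" using D_UN[of n] by auto
      then show "x \<in> (\<Union>m. Q m)"
        using n by (intro UN_I[of "prod_encode (n, i)"]) (auto simp: Q_def)
    qed
  qed (auto simp: Q_def split: prod.splits)
  have le: "emeasure \<nu> (Q m) \<le> ennreal stopping_const * emeasure \<nu> (Q m \<inter> G)" for m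
  proof -
    obtain n i where m: "prod_decode m = (n, i)" by fastforce
    let ?E = "{x \<in> space M. \<tau> x = enat n}"
    have Qm: "Q m = ?E \<inter> D n i" by (simp add: Q_def m)
    have "?E \<subseteq> cover n (A n)" using hitting_time_eqD by (auto simp: \<tau>_def)
    note E = stopping_time_ext_eq[OF \<tau>, of n] this
    have "Q m \<in> sets (F n)" using E(1) D_sets by (auto simp: Qm)
    then have "atom_of M (F n) (Q m)"
      using atom_of_subset[OF subalg finite_measure_axioms D_atom, of "Q m" n i] by (simp add: Qm)
    note osc = oscillation[OF this]
    have An: "A n \<in> sets M" using A sets_F by blast
    have "emeasure \<nu> (Q m) \<le> ennreal stopping_const * emeasure \<nu> (Q m \<inter> A n)"
      unfolding stopping_const_def using An
    proof (subst (1 2) \<nu>)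
      show "(\<integral>\<^sup>+ x. ennreal (c powr p x) * indicator (Q m) x \<partial>M) \<le>
        ennreal (R * (R powr (r / q) * K powr (1 / q))) *
          (\<integral>\<^sup>+ x. ennreal (c powr p x) * indicator (Q m \<inter> A n) x \<partial>M)"
      proof (rule integral_const_powr_le[OF _ _ _ _ R K osc c _ int_g])
        show "prob (Q m) \<le> R * prob (Q m \<inter> A n)"
          unfolding Qm by (rule prob_le_prob_Int_cover[OF E A])
      qed (use An Ag in \<open>auto intro: less_imp_le\<close>)
    qed auto
    also have "\<dots> \<le> ennreal stopping_const * emeasure \<nu> (Q m \<inter> G)"
      using Ag An sets.sets_into_space[OF An] sets_\<nu>
      by (intro mult_left_mono emeasure_mono) (auto simp: G_def)
    finally show ?thesis .
  qed
  have "emeasure \<nu> (\<Union>m. Q m) = (\<Sum>m. emeasure \<nu> (Q m))"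
    using disj by (intro suminf_emeasure[symmetric]) (auto simp: sets_\<nu>)
  also have "\<dots> \<le> (\<Sum>m. ennreal stopping_const * emeasure \<nu> (Q m \<inter> G))"
    by (intro suminf_le le) auto
  also have "\<dots> = ennreal stopping_const * (\<Sum>m. emeasure \<nu> (Q m \<inter> G))" by simp
  also have "(\<Sum>m. emeasure \<nu> (Q m \<inter> G)) = emeasure \<nu> (\<Union>m. Q m \<inter> G)"
    using disj by (intro suminf_emeasure) (auto simp: sets_\<nu> disjoint_family_on_def)
  also have "ennreal stopping_const * \<dots> \<le> ennreal stopping_const * emeasure \<nu> G"
    by (intro mult_left_mono emeasure_mono) (auto simp: sets_\<nu>)
  finally have "emeasure \<nu> {x \<in> space M. \<tau> x < \<infinity>} \<le> ennreal stopping_const * emeasure \<nu> G"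
    by (simp add: UN)
  then show ?thesis
    using stopping_time_ext_finite_sets[OF \<tau>]
    by (simp add: \<nu> finite_ind_def G_def \<tau>_def)
qed

text \<open>
  For an adapted process \<open>u\<close>, the first time \<open>n\<close> such that \<open>u (n + 1)\<close> exceeds \<open>2 powr k\<close> with positive
  probability within the present atom of \<open>F n\<close>. It comes before the level is passed, so
  that almost everywhere \<open>u\<close> is at most \<open>2 powr k\<close> from the index \<open>1\<close> up to and including this time.
\<close>

definition level_time :: "(nat \<Rightarrow> 'a \<Rightarrow> real) \<Rightarrow> int \<Rightarrow> 'a \<Rightarrow> enat"
  where "level_time u k = hitting_time (\<lambda>n. cover n {x \<in> space M. 2 powr k < u (Suc n) x})"

text \<open>The constant of \<open>integral_level_time_le\<close>.\<close>

definition level_const :: real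
  where "level_const = stopping_const * (1 / (1 - 2 powr - q))"

context
  fixes u :: "nat \<Rightarrow> 'a \<Rightarrow> real"
  assumes u: "\<And>n. u n \<in> borel_measurable (F n)"
begin

lemma level_sets: "{x \<in> space M. c < u (Suc n) x} \<in> sets (F (Suc n))"
  using borel_measurable_less[of "\<lambda>_. c" "F (Suc n)" "u (Suc n)"] u[of "Suc n"]
  by (simp add: space_F)

lemma stopping_time_level_time: "stopping_time_ext M F (level_time u k)"
  unfolding level_time_def by (intro stopping_time_ext_hitting_time cover_sets)

lemma level_time_mono:
  assumes "k \<le> l" shows "level_time u k x \<le> level_time u l x"
  unfolding level_time_def
proof (intro hitting_time_antimono cover_mono)
  have "(2 :: real) powr k \<le> 2 powr l" using assms by simp
  then show "{x \<in> space M. 2 powr l < u (Suc n) x} \<subseteq> {x \<in> space M. 2 powr k < u (Suc n) x}" for n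
    by (auto simp del: powr_le_cancel_iff intro: le_less_trans)
qed (rule sets_F[OF level_sets])

lemma AE_le_before_level_time:
  "AE x in M. \<forall>k n. enat (Suc n) \<le> level_time u k x \<longrightarrow> u (Suc n) x \<le> 2 powr k"
proof -
  have "AE x in M. enat (Suc n) \<le> level_time u k x \<longrightarrow> u (Suc n) x \<le> 2 powr k" for k n
  proof -
    have "AE x in M. x \<in> {x \<in> space M. 2 powr k < u (Suc n) x} \<longrightarrow>
        x \<in> cover n {x \<in> space M. 2 powr k < u (Suc n) x}"
      by (rule AE_cover[OF sets_F[OF level_sets]])
    then show ?thesis using AE_space
    proof eventually_elim
      case (elim x)
      have "level_time u k x \<le> enat n" if "2 powr k < u (Suc n) x"
        using elim that unfolding level_time_def hitting_time_le_iff by auto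
      moreover have "\<not> enat (Suc n) \<le> enat n" by simp
      ultimately show ?case by (meson not_le order_trans)
    qed
  qed
  then show ?thesis by (simp add: AE_all_countable)
qed

lemma integral_level_time_le:
  assumes int_u: "(\<integral>\<^sup>+ x. ennpowr (SUP n. ennreal (u n x)) (p x) \<partial>M) \<le> 1"
  shows "(\<integral>\<^sup>+ x. (\<Sum>k. ennreal ((2 ^ k) powr p x) * finite_ind M (level_time u (int k)) x) \<partial>M)
    \<le> ennreal level_const"
proof -
  define g where "g x = (SUP n. ennreal (u n x))" for x
  have [measurable]: "u n \<in> borel_measurable M" for n using u by (rule measurable_F)
  have g [measurable]: "g \<in> borel_measurable M" unfolding g_def by measurable
  have [measurable]: "finite_ind M (level_time u k) \<in> borel_measurable M" for k
    unfolding finite_ind_def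
    by (rule borel_measurable_indicator[OF stopping_time_ext_finite_sets[OF stopping_time_level_time]])
  have "(\<integral>\<^sup>+ x. (\<Sum>k. ennreal ((2 ^ k) powr p x) * finite_ind M (level_time u (int k)) x) \<partial>M)
    = (\<Sum>k. \<integral>\<^sup>+ x. ennreal ((2 ^ k) powr p x) * finite_ind M (level_time u (int k)) x \<partial>M)"
    by (rule nn_integral_suminf) measurable
  also have "\<dots> \<le> (\<Sum>k. ennreal stopping_const *
      (\<integral>\<^sup>+ x. ennreal ((2 ^ k) powr p x) * indicator {x \<in> space M. ennreal (2 ^ k) < g x} x \<partial>M))"
  proof (intro suminf_le)
    fix k :: nat
    have eq: "2 powr int k = (2 :: real) ^ k" by (simp add: powr_realpow)
    have "ennreal (2 ^ k) < g x" if "2 ^ k < u (Suc n) x" for n x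
    proof -
      have "ennreal (2 ^ k) < ennreal (u (Suc n) x)" using that
        by (subst ennreal_less_iff) auto
      also have "\<dots> \<le> g x" unfolding g_def by (rule SUP_upper) simp
      finally show ?thesis .
    qed
    then show "(\<integral>\<^sup>+ x. ennreal ((2 ^ k) powr p x) * finite_ind M (level_time u (int k)) x \<partial>M)
        \<le> ennreal stopping_const *
      (\<integral>\<^sup>+ x. ennreal ((2 ^ k) powr p x) * indicator {x \<in> space M. ennreal (2 ^ k) < g x} x \<partial>M)"
      unfolding level_time_def eq
      by (intro integral_hitting_time_cover_le level_sets g) (use int_u in \<open>auto simp: g_def\<close>)
  qed auto
  also have "\<dots> = ennreal stopping_const * (\<Sum>k.
      \<integral>\<^sup>+ x. ennreal ((2 ^ k) powr p x) * indicator {x \<in> space M. ennreal (2 ^ k) < g x} x \<partial>M)"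
    by simp
  also have "\<dots> \<le> ennreal stopping_const * ennreal (1 / (1 - 2 powr - q))"
    using int_u by (intro mult_left_mono integral_layers_le g) (auto simp: g_def)
  also have "\<dots> = ennreal level_const"
    using R q_pos unfolding level_const_def stopping_const_def
    by (intro ennreal_mult[symmetric]) (auto simp: powr_less_one less_imp_le)
  finally show ?thesis .
qed

end

lemma AE_finitely_many_levels:
  assumes \<tau>: "\<And>k. stopping_time_ext M F (\<tau> k)"
    and int: "(\<integral>\<^sup>+ x. (\<Sum>k. ennreal ((2 ^ k) powr p x) * finite_ind M (\<tau> (int k)) x) \<partial>M) < \<infinity>"
  shows "AE x in M. \<exists>k. \<tau> k x = \<infinity>"
proof -
  have [measurable]: "finite_ind M (\<tau> k) \<in> borel_measurable M" for k
    unfolding finite_ind_def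
    by (rule borel_measurable_indicator[OF stopping_time_ext_finite_sets[OF \<tau>]])
  have "AE x in M. (\<Sum>k. ennreal ((2 ^ k) powr p x) * finite_ind M (\<tau> (int k)) x) \<noteq> \<infinity>"
    using int by (intro nn_integral_PInf_AE) auto
  then show ?thesis using p_bounds AE_space
  proof eventually_elim
    case (elim x)
    show ?case
    proof (rule ccontr)
      assume "\<nexists>k. \<tau> k x = \<infinity>"
      then have fin: "finite_ind M (\<tau> k) x = 1" for k
        using elim by (simp add: finite_ind_def less_top)
      have "(1 :: ennreal) \<le> ennreal ((2 ^ k) powr p x) * finite_ind M (\<tau> (int k)) x" for k
        using elim q_pos ge_one_powr_ge_zero[of "2 ^ k" "p x"] by (simp add: fin)
      then have "(\<Sum>k<n. 1) \<le> (\<Sum>k<n. ennreal ((2 ^ k) powr p x) * finite_ind M (\<tau> (int k)) x)" for n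
        by (rule sum_mono)
      also have "\<dots> n \<le> (\<Sum>k. ennreal ((2 ^ k) powr p x) * finite_ind M (\<tau> (int k)) x)" for n
        by (intro sum_le_suminf) auto
      finally have "of_nat n \<le> (\<Sum>k. ennreal ((2 ^ k) powr p x) * finite_ind M (\<tau> (int k)) x)" for n
        by simp
      then show False using elim ennreal_Ex_less_of_nat not_less by (metis infinity_ennreal_def less_top)
    qed
  qed
qed

end

section \<open>Martingales\<close>

sublocale filtered_prob_space \<subseteq> sub: sigma_finite_subalgebra M "F n" for n
  by (intro finite_measure_subalgebra_is_sigma_finite)
     (simp add: finite_measure_subalgebra_def finite_measure_subalgebra_axioms_def
        finite_measure_axioms subalg)

lemma integrable_mult_squares:
  fixes f g :: "'a \<Rightarrow> real"
  assumes [measurable]: "f \<in> borel_measurable M" "g \<in> borel_measurable M"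
    and "integrable M (\<lambda>x. (f x)\<^sup>2)" "integrable M (\<lambda>x. (g x)\<^sup>2)"
  shows "integrable M (\<lambda>x. f x * g x)"
proof (rule Bochner_Integration.integrable_bound)
  show "integrable M (\<lambda>x. (f x)\<^sup>2 + (g x)\<^sup>2)" using assms by simp
  have "\<bar>a * b\<bar> \<le> a\<^sup>2 + b\<^sup>2" for a b :: real
    using sum_squares_bound[of "\<bar>a\<bar>" "\<bar>b\<bar>"] mult_nonneg_nonneg[of "\<bar>a\<bar>" "\<bar>b\<bar>"]
    unfolding abs_mult power2_abs by linarith
  then show "AE x in M. norm (f x * g x) \<le> norm ((f x)\<^sup>2 + (g x)\<^sup>2)" by simp
qed simp

context filtered_prob_space
begin

text \<open>
  A martingale in the sense of \<^const>\<open>martingale\<close> is adapted only up to null sets; the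
  arguments below use versions that are adapted everywhere.
\<close>

definition adapted_martingale :: "(nat \<Rightarrow> 'a \<Rightarrow> real) \<Rightarrow> bool"
  where "adapted_martingale g \<longleftrightarrow> martingale M F g \<and> (\<forall>n. g n \<in> borel_measurable (F n))"

lemma adapted_martingaleD:
  assumes "adapted_martingale g"
  shows "integrable M (g n)" "g n \<in> borel_measurable (F n)" "g n \<in> borel_measurable M"
    "AE x in M. real_cond_exp M (F n) (g (Suc n)) x = g n x"
  using assms measurable_F by (auto simp: adapted_martingale_def martingale_def)

lemma adapted_version:
  assumes f: "martingale M F f"
  obtains g where "adapted_martingale g" "AE x in M. \<forall>n. g n x = f n x"
proof
  let ?g = "\<lambda>n. real_cond_exp M (F n) (f (Suc n))"
  have int: "integrable M (f n)" and ae: "AE x in M. ?g n x = f n x" for n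
    using f by (auto simp: martingale_def)
  have [measurable]: "f n \<in> borel_measurable M" for n using int by auto
  have [measurable]: "?g n \<in> borel_measurable M" for n by (rule measurable_F[OF borel_measurable_cond_exp])
  show "AE x in M. \<forall>n. ?g n x = f n x" using ae by (simp add: AE_all_countable)
  have "AE x in M. real_cond_exp M (F n) (?g (Suc n)) x = ?g n x" for n
    by (intro sub.real_cond_exp_cong ae) auto
  moreover have "integrable M (?g n)" for n by (intro sub.real_cond_exp_int int)
  ultimately show "adapted_martingale ?g" by (simp add: adapted_martingale_def martingale_def)
qed

lemma adapted_martingale_diff:
  assumes "adapted_martingale g" "adapted_martingale h"
  shows "adapted_martingale (\<lambda>n x. g n x - h n x)"
proof -
  note g = adapted_martingaleD[OF assms(1)] and h = adapted_martingaleD[OF assms(2)]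
  have "AE x in M. real_cond_exp M (F n) (\<lambda>x. g (Suc n) x - h (Suc n) x) x = g n x - h n x" for n
    using sub.real_cond_exp_diff[OF g(1) h(1), of n "Suc n" "Suc n"] g(4)[of n] h(4)[of n]
    by eventually_elim simp
  then show ?thesis using g h by (auto simp: adapted_martingale_def martingale_def)
qed

lemma adapted_martingale_stop:
  assumes "adapted_martingale g" and \<tau>: "stopping_time_ext M F \<tau>"
  shows "adapted_martingale (\<lambda>n x. stop_seq (\<tau> x) (\<lambda>j. g j x) n)"
proof -
  note g = adapted_martingaleD[OF assms(1)]
  define G where "G n x = stop_seq (\<tau> x) (\<lambda>j. g j x) n" for n x
  define A where "A n = {x \<in> space M. enat (Suc n) \<le> \<tau> x}" for n
  have A: "A n \<in> sets (F n)" for n unfolding A_def by (rule stopping_time_ext_ge[OF \<tau>])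
  have AM: "A n \<in> sets M" for n using A sets_F by blast
  \<comment> \<open>The stopped process is a transform of \<open>g\<close> by predictable indicators.\<close>
  have G_Suc: "G (Suc n) x = G n x + indicator (A n) x * (g (Suc n) x - g n x)"
    if "x \<in> space M" for n x
    using that by (simp add: G_def A_def stop_seq_Suc)
  have G0: "G 0 x = g 0 x" for x by (simp add: G_def)
  have meas: "G n \<in> borel_measurable (F n)" for n
  proof (induction n)
    case 0
    have "G 0 = g 0" by (simp add: G0 fun_eq_iff)
    then show ?case using g(2) by simp
  next
    case (Suc n)
    have [measurable]: "G n \<in> borel_measurable (F (Suc n))" "g n \<in> borel_measurable (F (Suc n))"
      using measurable_F_mono[of _ n "Suc n"] Suc g(2) by auto
    have [measurable]: "A n \<in> sets (F (Suc n))" using A F_mono[of n "Suc n"] by auto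
    have [measurable]: "g (Suc n) \<in> borel_measurable (F (Suc n))" by (rule g(2))
    have "(\<lambda>x. G n x + indicator (A n) x * (g (Suc n) x - g n x)) \<in> borel_measurable (F (Suc n))"
      by measurable
    then show ?case
      by (rule measurable_cong[THEN iffD2, rotated]) (simp add: space_F G_Suc)
  qed
  have inc: "integrable M (\<lambda>x. indicator (A n) x * (g (Suc n) x - g n x))" for n
    using integrable_mult_indicator[OF AM, of "\<lambda>x. g (Suc n) x - g n x"] g(1) by simp
  have int: "integrable M (G n)" for n
  proof (induction n)
    case 0
    have "G 0 = g 0" by (simp add: G0 fun_eq_iff)
    then show ?case using g(1) by simp
  next
    case (Suc n)
    have "integrable M (\<lambda>x. G n x + indicator (A n) x * (g (Suc n) x - g n x))"
      using Suc inc by simp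
    then show ?case
      by (rule Bochner_Integration.integrable_cong[THEN iffD2, rotated -1]) (auto simp: G_Suc)
  qed
  have "AE x in M. real_cond_exp M (F n) (G (Suc n)) x = G n x" for n
  proof -
    have [measurable]: "g k \<in> borel_measurable M" "G k \<in> borel_measurable M" "A k \<in> sets M" for k
      using g(3) meas measurable_F AM by auto
    have "AE x in M. real_cond_exp M (F n) (G (Suc n)) x
        = real_cond_exp M (F n) (\<lambda>x. G n x + indicator (A n) x * (g (Suc n) x - g n x)) x"
      using AE_space by (intro sub.real_cond_exp_cong) (auto simp: G_Suc)
    moreover have "AE x in M. real_cond_exp M (F n) (\<lambda>x. G n x + indicator (A n) x * (g (Suc n) x - g n x)) x
        = real_cond_exp M (F n) (G n) x
          + real_cond_exp M (F n) (\<lambda>x. indicator (A n) x * (g (Suc n) x - g n x)) x"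
      by (intro sub.real_cond_exp_add int inc)
    moreover have "AE x in M. real_cond_exp M (F n) (G n) x = G n x"
      by (intro sub.real_cond_exp_F_meas int meas)
    moreover have "AE x in M. real_cond_exp M (F n) (\<lambda>x. indicator (A n) x * (g (Suc n) x - g n x)) x
        = indicator (A n) x * real_cond_exp M (F n) (\<lambda>x. g (Suc n) x - g n x) x"
      by (intro sub.real_cond_exp_mult inc borel_measurable_indicator A) simp
    moreover have "AE x in M. real_cond_exp M (F n) (\<lambda>x. g (Suc n) x - g n x) x
        = real_cond_exp M (F n) (g (Suc n)) x - real_cond_exp M (F n) (g n) x"
      by (intro sub.real_cond_exp_diff g)
    moreover have "AE x in M. real_cond_exp M (F n) (g n) x = g n x"
      by (intro sub.real_cond_exp_F_meas g)
    ultimately show ?thesis using g(4)[of n] by eventually_elim simp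
  qed
  then show ?thesis
    using meas int unfolding adapted_martingale_def martingale_def G_def by blast
qed

lemma integral_mult_martingale:
  assumes "adapted_martingale g" and v: "v \<in> borel_measurable (F n)"
    and int: "\<And>m. n \<le> m \<Longrightarrow> integrable M (\<lambda>x. v x * g m x)" and "n \<le> m"
  shows "(\<integral>x. v x * g m x \<partial>M) = (\<integral>x. v x * g n x \<partial>M)"
  using \<open>n \<le> m\<close>
proof (induction m rule: dec_induct)
  case (step m)
  note g = adapted_martingaleD[OF assms(1)]
  have v': "v \<in> borel_measurable (F m)" using measurable_F_mono[OF v] step by auto
  have [measurable]: "v \<in> borel_measurable M" "\<And>n. g n \<in> borel_measurable M"
    using v measurable_F g by auto
  have "(\<integral>x. v x * g (Suc m) x \<partial>M) = (\<integral>x. real_cond_exp M (F m) (\<lambda>x. v x * g (Suc m) x) x \<partial>M)"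
    using sub.real_cond_exp_int(2)[OF int[of "Suc m"]] step by simp
  also have "\<dots> = (\<integral>x. v x * g m x \<partial>M)"
  proof (intro integral_cong_AE)
    have "AE x in M. real_cond_exp M (F m) (\<lambda>x. v x * g (Suc m) x) x
        = v x * real_cond_exp M (F m) (g (Suc m)) x"
      using step by (intro sub.real_cond_exp_mult v' int) auto
    then show "AE x in M. real_cond_exp M (F m) (\<lambda>x. v x * g (Suc m) x) x = v x * g m x"
      using g(4)[of m] by eventually_elim simp
  qed (auto intro: measurable_F)
  finally show ?case using step by simp
qed simp

text \<open>Orthogonality of increments.\<close>

lemma integral_increment_squared:
  assumes mart: "adapted_martingale g" and sq: "\<And>n. integrable M (\<lambda>x. (g n x)\<^sup>2)" and "n \<le> m"
  shows "integrable M (\<lambda>x. (g m x - g n x)\<^sup>2)"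
    and "(\<integral>x. (g m x - g n x)\<^sup>2 \<partial>M) = (\<integral>x. (g m x)\<^sup>2 \<partial>M) - (\<integral>x. (g n x)\<^sup>2 \<partial>M)"
proof -
  note g = adapted_martingaleD[OF mart]
  have prod: "integrable M (\<lambda>x. g n x * g m x)" for n m
    by (intro integrable_mult_squares sq g)
  have eq: "(g m x - g n x)\<^sup>2 = (g m x)\<^sup>2 - 2 * (g n x * g m x) + (g n x)\<^sup>2" for x
    by (simp add: power2_diff algebra_simps)
  show "integrable M (\<lambda>x. (g m x - g n x)\<^sup>2)" unfolding eq using sq prod by simp
  have "(\<integral>x. g n x * g m x \<partial>M) = (\<integral>x. (g n x)\<^sup>2 \<partial>M)"
    using integral_mult_martingale[OF mart g(2) prod \<open>n \<le> m\<close>] by (simp add: power2_eq_square)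
  then show "(\<integral>x. (g m x - g n x)\<^sup>2 \<partial>M) = (\<integral>x. (g m x)\<^sup>2 \<partial>M) - (\<integral>x. (g n x)\<^sup>2 \<partial>M)"
    unfolding eq using sq prod by simp
qed

text \<open>
  A martingale that is bounded in \<open>L\<^sup>2\<close> consists of the conditional expectations of one
  integrable function, the limit in \<open>L\<^sup>1\<close> of a rapidly converging subsequence.
\<close>

lemma martingale_closure:
  assumes mart: "adapted_martingale g" and sq: "\<And>n. integrable M (\<lambda>x. (g n x)\<^sup>2)"
    and bound: "\<And>n. (\<integral>x. (g n x)\<^sup>2 \<partial>M) \<le> B"
  obtains a where "integrable M a" "\<And>n. AE x in M. real_cond_exp M (F n) a x = g n x"
proof -
  note g = adapted_martingaleD[OF mart]
  have [measurable]: "g n \<in> borel_measurable M" for n by (rule g(3))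
  define e where "e n = (\<integral>x. (g n x)\<^sup>2 \<partial>M)" for n
  have diff: "(\<integral>x. (g m x - g n x)\<^sup>2 \<partial>M) = e m - e n" if "n \<le> m" for n m
    unfolding e_def by (rule integral_increment_squared(2)[OF mart sq that])
  have mono: "e n \<le> e m" if "n \<le> m" for n m
  proof -
    have "0 \<le> (\<integral>x. (g m x - g n x)\<^sup>2 \<partial>M)" by simp
    then show ?thesis unfolding diff[OF that] by simp
  qed
  then have inc: "incseq e" by (simp add: incseq_def)
  \<comment> \<open>The energies converge; \<open>s\<close> selects a subsequence with gaps of energy below \<open>(1/4) ^ j\<close>.\<close>
  obtain L where L: "e \<longlonglongrightarrow> L" "\<And>n. e n \<le> L"
    using incseq_convergent[OF inc, of B] bound unfolding e_def by blast
  have "\<exists>N. \<forall>n\<ge>N. L - e n < (1/4) ^ j" for j :: nat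
  proof -
    have "L - (1/4) ^ j < L" by simp
    then have "\<forall>\<^sub>F n in sequentially. L - (1/4) ^ j < e n" by (rule order_tendstoD(1)[OF L(1)])
    then show ?thesis by (simp add: eventually_sequentially algebra_simps)
  qed
  then obtain N where N: "\<And>j n. N j \<le> n \<Longrightarrow> L - e n < (1/4) ^ j" by metis
  define s where "s j = j + (\<Sum>i\<le>j. N i)" for j
  have sN: "N j \<le> s j" for j unfolding s_def by (intro trans_le_add2 member_le_sum) auto
  have sj: "j \<le> s j" for j by (simp add: s_def)
  have sSuc: "s j \<le> s (Suc j)" for j by (simp add: s_def)
  define h where "h j x = g (s (Suc j)) x - g (s j) x" for j x
  have h_int: "integrable M (h j)" for j unfolding h_def using g(1) by simp
  have h_sq: "integrable M (\<lambda>x. (h j x)\<^sup>2)" for j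
    unfolding h_def by (rule integral_increment_squared(1)[OF mart sq sSuc])
  have h_le: "(\<integral>x. \<bar>h j x\<bar> \<partial>M) \<le> (1/2) ^ j" for j
  proof -
    have "(\<integral>x. (h j x)\<^sup>2 \<partial>M) \<le> (1/4) ^ j"
      unfolding h_def diff[OF sSuc] using N[OF sN, of j] L(2)[of "s (Suc j)"] by simp
    then have *: "2 ^ j * (\<integral>x. (h j x)\<^sup>2 \<partial>M) \<le> 2 ^ j * (1/4) ^ j"
      by (intro mult_left_mono) auto
    \<comment> \<open>This replaces the Cauchy-Schwarz inequality when passing from \<open>L\<^sup>2\<close> to \<open>L\<^sup>1\<close>.\<close>
    have pt: "2 * \<bar>y\<bar> \<le> (1/2) ^ j + 2 ^ j * y\<^sup>2" for y :: real
    proof -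
      have "0 \<le> 2 ^ j * (\<bar>y\<bar> - (1/2) ^ j)\<^sup>2" by simp
      also have "\<dots> = 2 ^ j * y\<^sup>2 - 2 * \<bar>y\<bar> * (2 ^ j * (1/2) ^ j) + (2 ^ j * (1/2) ^ j) * (1/2) ^ j"
        by (simp add: power2_eq_square algebra_simps)
      also have "2 ^ j * (1/2 :: real) ^ j = 1" by (simp flip: power_mult_distrib)
      finally show ?thesis by simp
    qed
    have "(\<integral>x. 2 * \<bar>h j x\<bar> \<partial>M) \<le> (\<integral>x. (1/2) ^ j + 2 ^ j * (h j x)\<^sup>2 \<partial>M)"
      using h_int h_sq by (intro integral_mono pt) auto
    also have "\<dots> = (1/2) ^ j + 2 ^ j * (\<integral>x. (h j x)\<^sup>2 \<partial>M)"
      using h_sq by (simp add: prob_space)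
    also have "\<dots> \<le> (1/2) ^ j + 2 ^ j * (1/4) ^ j" using * by simp
    also have "2 ^ j * (1/4) ^ j = (1/2 :: real) ^ j" by (simp flip: power_mult_distrib)
    finally show ?thesis by simp
  qed
  have summ: "summable (\<lambda>j. \<integral>x. \<bar>h j x\<bar> \<partial>M)"
    by (rule summable_comparison_test[OF _ summable_geometric[of "1/2 :: real"]])
       (use h_le in \<open>auto intro!: exI[of _ 0]\<close>)
  have ae: "AE x in M. summable (\<lambda>j. \<bar>h j x\<bar>)"
  proof -
    have [measurable]: "h j \<in> borel_measurable M" for j using h_int by auto
    have "(\<integral>\<^sup>+ x. (\<Sum>j. ennreal \<bar>h j x\<bar>) \<partial>M) = (\<Sum>j. \<integral>\<^sup>+ x. ennreal \<bar>h j x\<bar> \<partial>M)"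
      by (rule nn_integral_suminf) measurable
    also have "\<dots> = (\<Sum>j. ennreal (\<integral>x. \<bar>h j x\<bar> \<partial>M))"
      using h_int by (intro suminf_cong nn_integral_eq_integral) auto
    also have "\<dots> \<noteq> \<infinity>"
      using summ by (simp add: ennreal_suminf_neq_top)
    finally have "AE x in M. (\<Sum>j. ennreal \<bar>h j x\<bar>) \<noteq> \<infinity>" by (intro nn_integral_PInf_AE) auto
    then show ?thesis by eventually_elim (auto intro: summable_suminf_not_top)
  qed
  define a where "a x = g (s 0) x + (\<Sum>j. h j x)" for x
  have a_int: "integrable M a"
    unfolding a_def using integrable_suminf[of M h] h_int ae summ g(1) by simp
  have "AE x in M. real_cond_exp M (F n) a x = g n x" for n
  proof (rule sub.real_cond_exp_charact[OF _ a_int g(1) g(2)])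
    fix A assume A: "A \<in> sets (F n)"
    then have AM [measurable]: "A \<in> sets M" by (rule sets_F)
    have ind: "integrable M (\<lambda>x. indicator A x * f x)" if "integrable M f" for f :: "'a \<Rightarrow> real"
      using integrable_mult_indicator[OF AM that] by simp
    have "(\<lambda>j. \<integral>x. indicator A x * h j x \<partial>M) sums (\<integral>x. (\<Sum>j. indicator A x * h j x) \<partial>M)"
    proof (rule sums_integral)
      show "AE x in M. summable (\<lambda>j. norm (indicator A x * h j x))"
        using ae by eventually_elim (auto simp: abs_mult intro: summable_mult)
      show "summable (\<lambda>j. \<integral>x. norm (indicator A x * h j x) \<partial>M)"
      proof (rule summable_comparison_test[OF _ summ], intro exI[of _ 0] allI impI)
        fix j
        have "(\<integral>x. norm (indicator A x * h j x) \<partial>M) \<le> (\<integral>x. \<bar>h j x\<bar> \<partial>M)"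
          using h_int
          by (intro integral_mono integrable_norm ind) (auto split: split_indicator)
        then show "norm (\<integral>x. norm (indicator A x * h j x) \<partial>M) \<le> (\<integral>x. \<bar>h j x\<bar> \<partial>M)" by simp
      qed
    qed (rule ind[OF h_int])
    then have lim: "(\<lambda>J. \<Sum>j<J. \<integral>x. indicator A x * h j x \<partial>M)
        \<longlonglongrightarrow> (\<integral>x. (\<Sum>j. indicator A x * h j x) \<partial>M)"
      by (simp add: sums_def)
    have "(\<Sum>j<J. \<integral>x. indicator A x * h j x \<partial>M)
        = (\<integral>x. indicator A x * g n x \<partial>M) - (\<integral>x. indicator A x * g (s 0) x \<partial>M)" if "n \<le> J" for J
    proof -
      have "(\<integral>x. indicator A x * h j x \<partial>M)
          = (\<integral>x. indicator A x * g (s (Suc j)) x \<partial>M) - (\<integral>x. indicator A x * g (s j) x \<partial>M)" for j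
        using ind[OF g(1)] by (simp add: h_def right_diff_distrib)
      then have "(\<Sum>j<J. \<integral>x. indicator A x * h j x \<partial>M)
          = (\<integral>x. indicator A x * g (s J) x \<partial>M) - (\<integral>x. indicator A x * g (s 0) x \<partial>M)"
        using sum_lessThan_telescope[of "\<lambda>j. \<integral>x. indicator A x * g (s j) x \<partial>M" J] by simp
      also have "(\<integral>x. indicator A x * g (s J) x \<partial>M) = (\<integral>x. indicator A x * g n x \<partial>M)"
        using sj[of J] that A
        by (intro integral_mult_martingale[OF mart] ind g) auto
      finally show ?thesis .
    qed
    then have "(\<lambda>J. \<Sum>j<J. \<integral>x. indicator A x * h j x \<partial>M)
        \<longlonglongrightarrow> (\<integral>x. indicator A x * g n x \<partial>M) - (\<integral>x. indicator A x * g (s 0) x \<partial>M)"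
      by (intro tendsto_eventually eventually_sequentiallyI)
    with lim have eq: "(\<integral>x. (\<Sum>j. indicator A x * h j x) \<partial>M)
        = (\<integral>x. indicator A x * g n x \<partial>M) - (\<integral>x. indicator A x * g (s 0) x \<partial>M)"
      by (rule LIMSEQ_unique)
    have "(\<integral>x. indicator A x * a x \<partial>M)
        = (\<integral>x. indicator A x * g (s 0) x \<partial>M) + (\<integral>x. indicator A x * (\<Sum>j. h j x) \<partial>M)"
      unfolding a_def distrib_left using integrable_suminf[of M h] h_int ae summ
      by (intro Bochner_Integration.integral_add ind g) auto
    also have "(\<integral>x. indicator A x * (\<Sum>j. h j x) \<partial>M) = (\<integral>x. (\<Sum>j. indicator A x * h j x) \<partial>M)"
      using ae by (intro integral_cong_AE) (auto elim!: eventually_mono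
        simp: suminf_mult summable_rabs_cancel split: split_indicator intro!: borel_measurable_suminf borel_measurable_times h_int[THEN borel_measurable_integrable])
    finally show "(LINT x:A|M. a x) = (LINT x:A|M. g n x)"
      using eq by (simp add: set_lebesgue_integral_def)
  qed
  then show ?thesis using that a_int by blast
qed

end

text \<open>
  The energy inequality is the one property of \<open>U\<close> that concerns martingales and not single paths.
\<close>

locale martingale_seminorm = filtered_prob_space M F + seq_seminorm U
  for M :: "'a measure" and F U +
  assumes energy: "adapted_martingale g \<Longrightarrow> (\<And>n. integrable M (\<lambda>x. (g n x)\<^sup>2)) \<Longrightarrow>
    (\<integral>x. (g n x)\<^sup>2 \<partial>M) \<le> (\<integral>x. (U (\<lambda>j. g j x) n)\<^sup>2 \<partial>M)"
begin

lemma bounded_martingale_closure: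
  assumes mart: "adapted_martingale g" and bound: "AE x in M. \<forall>n. U (\<lambda>j. g j x) n \<le> c"
  obtains a where "integrable M a" "\<And>n. AE x in M. real_cond_exp M (F n) a x = g n x"
proof -
  note g = adapted_martingaleD[OF mart]
  have [measurable]: "g n \<in> borel_measurable M" for n by (rule g(3))
  have [measurable]: "(\<lambda>x. U (\<lambda>j. g j x) n) \<in> borel_measurable M" for n
    by (rule measurable) simp
  have U2: "AE x in M. (U (\<lambda>j. g j x) n)\<^sup>2 \<le> c\<^sup>2" for n
    using bound by eventually_elim (auto intro: power_mono nonneg)
  have sq: "integrable M (\<lambda>x. (g n x)\<^sup>2)" for n
  proof (rule integrable_const_bound)
    show "AE x in M. norm ((g n x)\<^sup>2) \<le> (real (n + 1) * c)\<^sup>2"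
      using bound
    proof eventually_elim
      case (elim x)
      have "\<bar>g n x\<bar> \<le> real (n + 1) * U (\<lambda>j. g j x) n" using abs_le[of "\<lambda>j. g j x" n] .
      also have "\<dots> \<le> real (n + 1) * c" using elim by (intro mult_left_mono) auto
      finally show ?case using power_mono[of "\<bar>g n x\<bar>" _ 2] by simp
    qed
  qed simp
  have "(\<integral>x. (g n x)\<^sup>2 \<partial>M) \<le> c\<^sup>2" for n
  proof -
    have "integrable M (\<lambda>x. (U (\<lambda>j. g j x) n)\<^sup>2)"
      using U2 by (intro integrable_const_bound[of _ "c\<^sup>2"]) auto
    then have "(\<integral>x. (U (\<lambda>j. g j x) n)\<^sup>2 \<partial>M) \<le> (\<integral>x. c\<^sup>2 \<partial>M)"
      using U2 by (intro integral_mono_AE) auto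
    then show ?thesis using energy[OF mart sq, of n] by (simp add: prob_space)
  qed
  then show ?thesis using martingale_closure[OF mart sq] that by blast
qed

end

lemma (in filtered_prob_space) martingale_seminorm_max: "martingale_seminorm M F max_seminorm"
  by unfold_locales (simp add: max_seminorm_def)

lemma (in filtered_prob_space) martingale_seminorm_square: "martingale_seminorm M F square_seminorm"
proof
  fix g n
  assume mart: "adapted_martingale g" and sq: "\<And>n. integrable M (\<lambda>x. (g n x)\<^sup>2)"
  have "integrable M (\<lambda>x. (square_seminorm (\<lambda>j. g j x) n)\<^sup>2) \<and>
    (\<integral>x. (g n x)\<^sup>2 \<partial>M) = (\<integral>x. (square_seminorm (\<lambda>j. g j x) n)\<^sup>2 \<partial>M)"
  proof (induction n)
    case 0
    then show ?case using sq[of 0] by (simp add: square_seminorm.at_0)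
  next
    case (Suc n)
    have "(square_seminorm s (Suc n))\<^sup>2 = (square_seminorm s n)\<^sup>2 + (s (Suc n) - s n)\<^sup>2" for s
      by (simp add: square_seminorm_def L2_set_def sum_nonneg increment_def)
    then show ?case
      using Suc integral_increment_squared[OF mart sq, of n "Suc n"] by simp
  qed
  then show "(\<integral>x. (g n x)\<^sup>2 \<partial>M) \<le> (\<integral>x. (square_seminorm (\<lambda>j. g j x) n)\<^sup>2 \<partial>M)" by simp
qed

section \<open>Atomic decompositions\<close>

text \<open>
  The ratio between the \<open>t\<close>-norm of a two-sided dyadic sequence cut off from above and its largest
  term.
\<close>

definition geom_const :: "real \<Rightarrow> real"
  where "geom_const t = (1 / (1 - 2 powr - t)) powr (1 / t)"

lemma geom_const_pos: "0 < t \<Longrightarrow> 0 < geom_const t"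
  using powr_less_one[of 2 "- t"] by (simp add: geom_const_def)

lemma ennpowr_level_sum_le:
  fixes b :: "int \<Rightarrow> ennreal" and k0 :: int
  assumes t: "0 < t" and c: "0 \<le> c"
    and b: "\<And>k. b k \<le> ennreal (c * 2 powr k)" and b0: "\<And>k. k > k0 \<Longrightarrow> b k = 0"
  shows "ennpowr (\<Sum>\<^sub>\<infinity>k\<in>UNIV. ennpowr (b k) t) (1 / t) \<le> ennreal (c * 2 powr k0 * geom_const t)"
proof -
  have pos: "0 < 1 - 2 powr - t" using t powr_less_one[of 2 "- t"] by simp
  let ?V = "(c * 2 powr k0) powr t / (1 - 2 powr - t)"
  have "(\<Sum>\<^sub>\<infinity>k\<in>UNIV. ennpowr (b k) t) \<le> ennreal ?V"
  proof (rule infsum_ennreal_le)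
    fix J :: "int set" assume J: "finite J"
    have "(\<Sum>k\<in>J. ennpowr (b k) t) = (\<Sum>k\<in>J \<inter> {..k0}. ennpowr (b k) t)"
    proof (rule sum.mono_neutral_right[OF J])
      show "\<forall>k\<in>J - J \<inter> {..k0}. ennpowr (b k) t = 0" by (auto simp: b0 not_le)
    qed simp
    also have "\<dots> \<le> (\<Sum>k\<in>J \<inter> {..k0}. ennreal ((c * 2 powr k) powr t))"
    proof (rule sum_mono)
      fix k
      have "ennpowr (b k) t \<le> ennpowr (ennreal (c * 2 powr k)) t"
        using t by (intro ennpowr_mono b) auto
      then show "ennpowr (b k) t \<le> ennreal ((c * 2 powr k) powr t)"
        using c by (simp add: ennpowr_ennreal)
    qed
    also have "\<dots> = ennreal (\<Sum>k\<in>J \<inter> {..k0}. (c * 2 powr k) powr t)" by simp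
    also have "\<dots> \<le> ennreal ?V"
      using J t c by (intro ennreal_leI sum_powr_int_le) auto
    finally show "(\<Sum>k\<in>J. ennpowr (b k) t) \<le> ennreal ?V" .
  qed
  then have "ennpowr (\<Sum>\<^sub>\<infinity>k\<in>UNIV. ennpowr (b k) t) (1 / t) \<le> ennpowr (ennreal ?V) (1 / t)"
    using t by (intro ennpowr_mono) auto
  also have "\<dots> = ennreal (?V powr (1 / t))" using pos by (simp add: ennpowr_ennreal)
  also have "?V powr (1 / t) = ((c * 2 powr k0) powr t * (1 / (1 - 2 powr - t))) powr (1 / t)" by simp
  also have "\<dots> = c * 2 powr k0 * geom_const t"
    unfolding geom_const_def using pos c t by (subst powr_mult) (auto simp: powr_powr)
  finally show ?thesis .
qed

context variable_exponent
begin

text \<open>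
  The factor \<open>4\<close> bounds the piece of a martingale between the times of the levels \<open>2 powr k\<close> and
  \<open>2 powr (k + 1)\<close> in terms of \<open>2 powr k\<close>. The last factor makes the modular at most \<open>1\<close>.
\<close>

definition atomic_const :: "real \<Rightarrow> real \<Rightarrow> real"
  where "atomic_const L t = 4 * geom_const t * (1 + L) powr (1 / q)"

lemma atomic_const_pos: "0 < t \<Longrightarrow> 0 \<le> L \<Longrightarrow> 0 < atomic_const L t"
  using geom_const_pos[of t] by (simp add: atomic_const_def)

text \<open>
  As the times \<open>\<tau> k\<close> increase with \<open>k\<close>, the coefficients at a point form a dyadic sequence that is
  cut off at the last \<open>k\<close> with \<open>\<tau> k < \<infinity>\<close>. The sum in the norm is therefore comparable to its last
  term, and the integral of the \<open>p\<close>-th power of this term is bounded by the hypothesis.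
\<close>

lemma decomposition_norm_le:
  fixes \<tau> :: "int \<Rightarrow> 'a \<Rightarrow> enat"
  assumes t: "0 < t" and l: "0 < l" and L: "0 \<le> L"
    and meas: "\<And>k. {x \<in> space M. \<tau> k x < \<infinity>} \<in> sets M"
    and mono: "\<And>k j x. k \<le> j \<Longrightarrow> \<tau> k x \<le> \<tau> j x"
    and levels: "(\<integral>\<^sup>+ x. (\<Sum>k. ennreal ((2 ^ k) powr p x) * finite_ind M (\<tau> (int k)) x) \<partial>M) \<le> ennreal L"
    and fin: "AE x in M. \<exists>k. \<tau> k x = \<infinity>"
    and terms: "AE x in M. \<forall>k. ennreal (\<mu> k) * finite_ind M (\<tau> k) x / var_norm M p (finite_ind M (\<tau> k))
      \<le> ennreal (4 * l * 2 powr k) * finite_ind M (\<tau> k) x"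
  shows "decomposition_norm M p t \<mu> \<tau> \<le> ennreal (atomic_const L t * l)"
  unfolding decomposition_norm_def
proof (rule var_norm_le)
  define X where "X x = ennpowr (\<Sum>\<^sub>\<infinity>k\<in>UNIV. ennpowr
      (ennreal (\<mu> k) * finite_ind M (\<tau> k) x / var_norm M p (finite_ind M (\<tau> k))) t) (1 / t)" for x
  define W where "W x = (\<Sum>k. ennreal ((2 ^ k) powr p x) * finite_ind M (\<tau> (int k)) x)" for x
  define C where "C = atomic_const L t"
  have C: "0 < C" unfolding C_def using t L by (rule atomic_const_pos)
  then show "0 < atomic_const L t * l" using l by (simp add: C_def)
  have [measurable]: "finite_ind M (\<tau> k) \<in> borel_measurable M" for k
    unfolding finite_ind_def by (rule borel_measurable_indicator[OF meas])
  \<comment> \<open>The summand \<open>1\<close> accounts for points where the last level is at most \<open>1\<close>, \<open>W\<close> for the others.\<close>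
  have "AE x in M. ennpowr (X x / ennreal (C * l)) (p x) \<le> ennreal (1 / (1 + L)) * (1 + W x)"
    using fin terms p_bounds AE_space
  proof eventually_elim
    case (elim x)
    let ?S = "{k. \<tau> k x < \<infinity>}"
    let ?b = "\<lambda>k. ennreal (\<mu> k) * finite_ind M (\<tau> k) x / var_norm M p (finite_ind M (\<tau> k))"
    have ind: "finite_ind M (\<tau> k) x = (if k \<in> ?S then 1 else 0)" for k
      using elim by (simp add: finite_ind_def)
    have b0: "?b k = 0" if "k \<notin> ?S" for k using that ind by simp
    have b: "?b k \<le> ennreal (4 * l * 2 powr k)" for k
      using elim(2)[rule_format, of k] ind[of k] by (auto split: if_splits)
    show ?case
    proof (cases "?S = {}")
      case True
      then have "finite_ind M (\<tau> k) x = 0" for k using ind by auto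
      then have "X x = 0" unfolding X_def by simp
      then show ?thesis by simp
    next
      case False
      obtain k1 where "\<tau> k1 x = \<infinity>" using elim by blast
      then have k1: "k \<le> k1" if "k \<in> ?S" for k
        using that mono[of k1 k x] by (cases "k1 \<le> k") auto
      obtain k2 where k2: "k2 \<in> ?S" using False by blast
      define k0 where "k0 = Max (?S \<inter> {k2..k1})"
      have "finite (?S \<inter> {k2..k1})" "?S \<inter> {k2..k1} \<noteq> {}" using k1 k2 by auto
      note Max = Max_in[OF this] Max_ge[OF this(1)]
      have k0: "k0 \<in> ?S" using Max(1) by (simp add: k0_def)
      have k0_max: "k \<le> k0" if "k \<in> ?S" for k
      proof (cases "k2 \<le> k")
        case True
        then show ?thesis using Max(2)[of k] that k1 by (simp add: k0_def)
      next
        case False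
        have "k2 \<le> k0" using Max(1) by (simp add: k0_def)
        then show ?thesis using False by simp
      qed
      have "?b k = 0" if "k0 < k" for k by (rule b0) (use k0_max[of k] that in force)
      then have "X x \<le> ennreal (4 * l * 2 powr k0 * geom_const t)"
        unfolding X_def using l by (intro ennpowr_level_sum_le[OF t _ b]) auto
      then have "X x / ennreal (C * l) \<le> ennreal (4 * l * 2 powr k0 * geom_const t) / ennreal (C * l)"
        by (rule divide_right_mono_ennreal)
      also have "\<dots> = ennreal (4 * l * 2 powr k0 * geom_const t / (C * l))"
        using C l t geom_const_pos[OF t] by (intro divide_ennreal) auto
      also have "4 * l * 2 powr k0 * geom_const t / (C * l) = (1 + L) powr (- 1 / q) * 2 powr k0"
        using l geom_const_pos[OF t] L
        by (simp add: C_def atomic_const_def powr_minus_divide field_simps)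
      finally have "ennpowr (X x / ennreal (C * l)) (p x)
          \<le> ennpowr (ennreal ((1 + L) powr (- 1 / q) * 2 powr k0)) (p x)"
        using elim q_pos by (intro ennpowr_mono) auto
      also have "\<dots> = ennreal (((1 + L) powr (- 1 / q)) powr p x * (2 powr k0) powr p x)"
        by (simp add: ennpowr_ennreal powr_mult)
      also have "\<dots> \<le> ennreal (1 / (1 + L) * (2 powr k0) powr p x)"
      proof (intro ennreal_leI mult_right_mono)
        have "(1 + L) powr (- 1 / q) \<le> (1 + L) powr 0"
          using L q_pos by (intro powr_mono) auto
        then have "((1 + L) powr (- 1 / q)) powr p x \<le> ((1 + L) powr (- 1 / q)) powr q"
          using elim L by (intro powr_mono') auto
        also have "\<dots> = 1 / (1 + L)" unfolding powr_powr using L q_pos by (simp add: powr_minus_divide)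
        finally show "((1 + L) powr (- 1 / q)) powr p x \<le> 1 / (1 + L)" .
      qed simp
      also have "\<dots> = ennreal (1 / (1 + L)) * ennreal ((2 powr k0) powr p x)"
        using L by (intro ennreal_mult) auto
      also have "\<dots> \<le> ennreal (1 / (1 + L)) * (1 + W x)"
      proof (intro mult_left_mono)
        show "ennreal ((2 powr k0) powr p x) \<le> 1 + W x"
        proof (cases "k0 \<le> 0")
          case True
          have "(2 :: real) powr k0 \<le> 1" using True powr_mono[of k0 0 2] by simp
          then have "(2 powr k0) powr p x \<le> 1" using elim q_pos by (intro powr_le1) auto
          then have "ennreal ((2 powr k0) powr p x) \<le> 1" by simp
          also have "1 \<le> 1 + W x" by simp
          finally show ?thesis .
        next
          case False
          have "ennreal ((2 powr k0) powr p x)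
              = (\<Sum>k\<in>{nat k0}. ennreal ((2 ^ k) powr p x) * finite_ind M (\<tau> (int k)) x)"
            using False k0 ind[of k0] by (simp flip: powr_realpow)
          also have "\<dots> \<le> W x" unfolding W_def by (intro sum_le_suminf) auto
          also have "\<dots> \<le> 1 + W x" by simp
          finally show ?thesis .
        qed
      qed simp
      finally show ?thesis .
    qed
  qed
  then have "(\<integral>\<^sup>+ x. ennpowr (X x / ennreal (C * l)) (p x) \<partial>M)
      \<le> (\<integral>\<^sup>+ x. ennreal (1 / (1 + L)) * (1 + W x) \<partial>M)"
    by (rule nn_integral_mono_AE)
  also have "\<dots> = ennreal (1 / (1 + L)) * (1 + (\<integral>\<^sup>+ x. W x \<partial>M))"
    unfolding W_def by (subst nn_integral_cmult, measurable, subst nn_integral_add) (auto simp: emeasure_space_1)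
  also have "\<dots> \<le> ennreal (1 / (1 + L)) * (1 + ennreal L)"
    using levels unfolding W_def by (intro mult_left_mono add_left_mono) auto
  also have "\<dots> = ennreal (1 / (1 + L) * (1 + L))"
  proof -
    have "1 + ennreal L = ennreal (1 + L)" using L by (simp flip: ennreal_1)
    then show ?thesis using L by (simp only:) (rule ennreal_mult[symmetric], auto)
  qed
  also have "\<dots> = 1" using L by simp
  finally show "(\<integral>\<^sup>+ x. ennpowr (ennpowr (\<Sum>\<^sub>\<infinity>k\<in>UNIV. ennpowr
      (ennreal (\<mu> k) * finite_ind M (\<tau> k) x / var_norm M p (finite_ind M (\<tau> k))) t) (1 / t)
      / ennreal (atomic_const L t * l)) (p x) \<partial>M) \<le> 1"
    by (simp add: X_def C_def)
qed

end

text \<open>The filtration and the exponent, together with one of the two operators.\<close>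

locale hardy_setting = regular_atomic_filtration M F p q r D R K + martingale_seminorm M F U
  for M :: "'a measure" and F p q r D R K U
begin

text \<open>
  The operator applied to an atom vanishes where \<open>\<tau> = \<infinity>\<close> and is bounded by the reciprocal of the
  norm of the indicator of \<open>\<tau> < \<infinity>\<close>. By subadditivity, the operator applied to \<open>f\<close> is at most the sum
  in the atomic norm with exponent \<open>1\<close> instead of \<open>t\<close>, which is the smaller one as \<open>t \<le> 1\<close>.
\<close>

lemma hardy_norm_le_decomposition_norm:
  assumes t: "0 < t" "t \<le> 1" and d: "atomic_decomposition fun_of M F p f \<mu> \<tau> a"
  shows "hardy_norm fun_of M p f \<le> decomposition_norm M p t \<mu> \<tau>"
  unfolding hardy_norm_def decomposition_norm_def
proof (rule var_norm_mono)
  let ?N = "\<lambda>k. var_norm M p (finite_ind M (\<tau> k))"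
  let ?E = "\<lambda>k n. real_cond_exp M (F n) (a k)"
  have \<mu>: "0 < \<mu> k" and a: "var_atom fun_of M F p (\<tau> k) (a k)" for k
    using d by (auto simp: atomic_decomposition_def)
  have atom: "AE x in M. fun_of (?E k) x \<le> finite_ind M (\<tau> k) x / ?N k" for k
  proof -
    have "AE x in M. \<forall>n. enat n \<le> \<tau> k x \<longrightarrow> ?E k n x = 0"
      using a[of k] by (simp add: var_atom_def AE_all_countable)
    then show ?thesis using esssup_AE[of "fun_of (?E k)" M] AE_space
    proof eventually_elim
      case (elim x)
      show ?case
      proof (cases "\<tau> k x = \<infinity>")
        case True
        then have "fun_of (?E k) x = 0" using elim by (intro fun_of_eq_0) auto
        then show ?thesis by simp
      next
        case False
        then have "finite_ind M (\<tau> k) x = 1" using elim by (simp add: finite_ind_def less_top)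
        then show ?thesis using elim(2) a[of k] by (auto simp: var_atom_def intro: order_trans)
      qed
    qed
  qed
  have "AE x in M. \<forall>k. fun_of (?E k) x \<le> finite_ind M (\<tau> k) x / ?N k"
    using atom by (simp add: AE_all_countable)
  moreover have "AE x in M. \<forall>n. ((\<lambda>k. \<mu> k * ?E k n x) has_sum f n x) UNIV"
    using d by (simp add: atomic_decomposition_def AE_all_countable)
  ultimately show "AE x in M. fun_of f x \<le> ennpowr (\<Sum>\<^sub>\<infinity>k\<in>UNIV. ennpowr
      (ennreal (\<mu> k) * finite_ind M (\<tau> k) x / ?N k) t) (1 / t)"
  proof eventually_elim
    case (elim x)
    have "fun_of f x \<le> (\<Sum>\<^sub>\<infinity>k\<in>UNIV. fun_of (\<lambda>n x. \<mu> k * ?E k n x) x)"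
      using elim(2) by (intro fun_of_has_sum) auto
    also have "\<dots> \<le> (\<Sum>\<^sub>\<infinity>k\<in>UNIV. ennreal (\<mu> k) * finite_ind M (\<tau> k) x / ?N k)"
    proof (rule infsum_mono)
      fix k
      have "fun_of (\<lambda>n x. \<mu> k * ?E k n x) x = ennreal (\<mu> k) * fun_of (?E k) x"
        using \<mu>[of k] by (simp add: fun_of_scale)
      also have "\<dots> \<le> ennreal (\<mu> k) * (finite_ind M (\<tau> k) x / ?N k)"
        using elim(1) by (intro mult_left_mono) auto
      finally show "fun_of (\<lambda>n x. \<mu> k * ?E k n x) x \<le> ennreal (\<mu> k) * finite_ind M (\<tau> k) x / ?N k"
        by (simp add: ennreal_times_divide)
    qed (simp_all add: nonneg_summable_on_complete)
    also have "\<dots> \<le> ennpowr (\<Sum>\<^sub>\<infinity>k\<in>UNIV. ennpowr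
      (ennreal (\<mu> k) * finite_ind M (\<tau> k) x / ?N k) t) (1 / t)"
      by (rule infsum_le_ennpowr_infsum[OF t])
    finally show ?case .
  qed
qed

text \<open>
  The closure of \<open>G\<close>, divided by \<open>c\<close> times the norm of the indicator of \<open>\<tau> < \<infinity>\<close>, is an atom. If
  \<open>\<tau> = \<infinity>\<close> almost everywhere, this norm is \<open>0\<close>; then \<open>G\<close> vanishes almost everywhere, and the atom
  is \<open>0\<close> with coefficient \<open>1\<close>, since coefficients have to be positive.
\<close>

lemma exists_normalized_atom:
  assumes \<tau>: "stopping_time_ext M F \<tau>" and mart: "adapted_martingale G" and c: "0 < c"
    and bound: "AE x in M. \<forall>n. U (\<lambda>j. G j x) n \<le> c"
    and zero: "\<And>n x. enat n \<le> \<tau> x \<Longrightarrow> G n x = 0"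
  shows "\<exists>m a. 0 < m \<and> var_atom fun_of M F p \<tau> a \<and>
    (\<forall>n. AE x in M. m * real_cond_exp M (F n) a x = G n x) \<and>
    (AE x in M. ennreal m * finite_ind M \<tau> x / var_norm M p (finite_ind M \<tau>)
      \<le> ennreal c * finite_ind M \<tau> x)"
proof -
  let ?N = "var_norm M p (finite_ind M \<tau>)"
  let ?T = "{x \<in> space M. \<tau> x < \<infinity>}"
  have T: "?T \<in> sets M" by (rule stopping_time_ext_finite_sets[OF \<tau>])
  have meas: "fun_of (\<lambda>n. real_cond_exp M (F n) a) \<in> borel_measurable M" for a
    by (intro fun_of_measurable measurable_F[OF borel_measurable_cond_exp])
  show ?thesis
  proof (cases "prob ?T = 0")
    case True
    then have "AE x in M. x \<notin> ?T" using T by (intro AE_not_in) (auto simp: emeasure_eq_measure)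
    then have inf: "AE x in M. \<tau> x = \<infinity>" using AE_space by eventually_elim auto
    have E0: "AE x in M. real_cond_exp M (F n) (\<lambda>x. 0) x = 0" for n
      by (rule sub.real_cond_exp_F_meas) auto
    then have "AE x in M. \<forall>n. real_cond_exp M (F n) (\<lambda>x. 0) x = 0" by (simp add: AE_all_countable)
    then have "AE x in M. fun_of (\<lambda>n. real_cond_exp M (F n) (\<lambda>x. 0)) x \<le> 0"
      by eventually_elim (simp add: fun_of_eq_0)
    then have "esssup M (fun_of (\<lambda>n. real_cond_exp M (F n) (\<lambda>x. 0))) \<le> 0"
      by (rule esssup_I[OF meas])
    then have "esssup M (fun_of (\<lambda>n. real_cond_exp M (F n) (\<lambda>x. 0))) \<le> 1 / ?N"
      by (rule order_trans) simp
    moreover have "AE x in M. enat n \<le> \<tau> x \<longrightarrow> real_cond_exp M (F n) (\<lambda>x. 0) x = 0" for n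
      using E0[of n] by eventually_elim simp
    ultimately have "var_atom fun_of M F p \<tau> (\<lambda>x. 0)"
      unfolding var_atom_def using \<tau> by auto
    moreover have "AE x in M. 1 * real_cond_exp M (F n) (\<lambda>x. 0) x = G n x" for n
      using inf E0[of n] by eventually_elim (simp add: zero)
    moreover have "AE x in M. ennreal 1 * finite_ind M \<tau> x / ?N \<le> ennreal c * finite_ind M \<tau> x"
      using inf by eventually_elim (simp add: finite_ind_def)
    ultimately show ?thesis by (intro exI[of _ 1] exI[of _ "\<lambda>x. 0"]) auto
  next
    case False
    have N0: "?N \<noteq> 0" using var_norm_indicator_eq_0[OF T] False by (auto simp: finite_ind_def)
    have N1: "?N \<le> 1" unfolding finite_ind_def by (rule var_norm_indicator_le_1[OF T])
    obtain N where N: "?N = ennreal N" "0 < N"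
      using N0 N1 by (cases ?N) (auto simp: top_unique)
    obtain b where b: "integrable M b" "\<And>n. AE x in M. real_cond_exp M (F n) b x = G n x"
      using bounded_martingale_closure[OF mart bound] by blast
    define m where "m = c * N"
    have m: "0 < m" using c N by (simp add: m_def)
    define a where "a x = b x / m" for x
    have a: "integrable M a" unfolding a_def using b(1) by simp
    have Ea: "AE x in M. real_cond_exp M (F n) a x = (1 / m) * G n x" for n
    proof -
      have "AE x in M. real_cond_exp M (F n) a x = real_cond_exp M (F n) b x / m"
        unfolding a_def by (rule sub.real_cond_exp_cdiv[OF b(1)])
      then show ?thesis using b(2)[of n] by eventually_elim simp
    qed
    then have "AE x in M. \<forall>n. real_cond_exp M (F n) a x = (1 / m) * G n x"
      by (simp add: AE_all_countable)
    then have "AE x in M. fun_of (\<lambda>n. real_cond_exp M (F n) a) x \<le> 1 / ?N"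
      using bound
    proof eventually_elim
      case (elim x)
      have "fun_of (\<lambda>n. real_cond_exp M (F n) a) x = fun_of (\<lambda>n x. (1 / m) * G n x) x"
        using elim by (intro fun_of_cong) auto
      also have "\<dots> = ennreal (1 / m) * fun_of G x"
        using fun_of_scale[of "1 / m" G x] m by simp
      also have "\<dots> \<le> ennreal (1 / m) * ennreal c"
        using elim by (intro mult_left_mono) (auto simp: fun_of_def intro!: SUP_least ennreal_leI)
      also have "\<dots> = ennreal (1 / m * c)" using m c by (intro ennreal_mult[symmetric]) auto
      also have "1 / m * c = 1 / N" using c by (simp add: m_def)
      also have "ennreal (1 / N) = 1 / ?N" using N divide_ennreal[of 1 N] by simp
      finally show ?case .
    qed
    then have "esssup M (fun_of (\<lambda>n. real_cond_exp M (F n) a)) \<le> 1 / ?N"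
      by (rule esssup_I[OF meas])
    moreover have "AE x in M. enat n \<le> \<tau> x \<longrightarrow> real_cond_exp M (F n) a x = 0" for n
      using Ea[of n] by eventually_elim (simp add: zero)
    ultimately have "var_atom fun_of M F p \<tau> a" unfolding var_atom_def using a \<tau> by blast
    moreover have "AE x in M. m * real_cond_exp M (F n) a x = G n x" for n
      using Ea[of n] by eventually_elim (use m in simp)
    moreover have "ennreal m * finite_ind M \<tau> x / ?N \<le> ennreal c * finite_ind M \<tau> x" for x
    proof -
      have "ennreal m / ?N = ennreal c" using N m c by (simp add: divide_ennreal m_def)
      then show ?thesis by (cases "\<tau> x < \<infinity> \<and> x \<in> space M") (auto simp: finite_ind_def)
    qed
    ultimately show ?thesis using m by blast
  qed
qed

lemma level_const_nonneg: "0 \<le> level_const"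
  using R q_pos unfolding level_const_def stopping_const_def
  by (intro mult_nonneg_nonneg) (auto simp: powr_less_one less_imp_le)

text \<open>
  The atoms are the normalised pieces of \<open>f\<close> between consecutive level times of the process
  \<open>n \<mapsto> U f n / l\<close>, where \<open>l\<close> is any scale admissible in the Hardy norm of \<open>f\<close>.
\<close>

lemma exists_atomic_decomposition:
  assumes f: "martingale M F f" and f0: "AE x in M. f 0 x = 0" and t: "0 < t" and l: "0 < l"
    and int: "(\<integral>\<^sup>+ x. ennpowr (fun_of f x / ennreal l) (p x) \<partial>M) \<le> 1"
  shows "\<exists>\<mu> \<tau> a. atomic_decomposition fun_of M F p f \<mu> \<tau> a \<and>
    decomposition_norm M p t \<mu> \<tau> \<le> ennreal (atomic_const level_const t * l)"
proof -
  obtain g where mart: "adapted_martingale g" and gf: "AE x in M. \<forall>n. g n x = f n x"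
    using adapted_version[OF f] .
  define u where "u n x = (1 / l) * U (\<lambda>j. g j x) n" for n x
  have u: "u n \<in> borel_measurable (F n)" for n
    unfolding u_def using adapted_martingaleD(2)[OF mart] measurable_F_mono
    by (intro borel_measurable_times borel_measurable_const measurable) auto
  have "(\<integral>\<^sup>+ x. ennpowr (SUP n. ennreal (u n x)) (p x) \<partial>M)
      = (\<integral>\<^sup>+ x. ennpowr (fun_of f x / ennreal l) (p x) \<partial>M)"
  proof (intro nn_integral_cong_AE, use gf in eventually_elim)
    case (elim x)
    have "(SUP n. ennreal (u n x)) = fun_of (\<lambda>n x. (1 / l) * g n x) x"
      using l by (simp add: u_def fun_of_def scale[of "1 / l", simplified])
    also have "\<dots> = ennreal (1 / l) * fun_of g x" using l fun_of_scale[of "1 / l" g x] by simp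
    also have "fun_of g x = fun_of f x" using elim by (intro fun_of_cong) auto
    also have "ennreal (1 / l) * fun_of f x = fun_of f x / ennreal l"
      using l divide_ennreal[of 1 l] by (simp add: divide_ennreal_def mult.commute)
    finally show ?case by simp
  qed
  with int have int_u: "(\<integral>\<^sup>+ x. ennpowr (SUP n. ennreal (u n x)) (p x) \<partial>M) \<le> 1" by simp
  define \<tau> where "\<tau> = level_time u"
  have \<tau>: "stopping_time_ext M F (\<tau> k)" for k
    unfolding \<tau>_def using stopping_time_level_time[of u k] u by blast
  have mono: "\<tau> k x \<le> \<tau> j x" if "k \<le> j" for k j x
    unfolding \<tau>_def using level_time_mono[of u k j x] u that by blast
  have levels: "(\<integral>\<^sup>+ x. (\<Sum>k. ennreal ((2 ^ k) powr p x) * finite_ind M (\<tau> (int k)) x) \<partial>M)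
      \<le> ennreal level_const"
    unfolding \<tau>_def using integral_level_time_le[of u] u int_u by blast
  have fin: "AE x in M. \<exists>k. \<tau> k x = \<infinity>"
    using levels by (intro AE_finitely_many_levels \<tau>) (auto intro: le_less_trans)
  have below: "AE x in M. \<forall>k n. enat n \<le> \<tau> k x \<longrightarrow> U (\<lambda>j. g j x) n \<le> l * 2 powr k"
  proof -
    have "AE x in M. \<forall>k n. enat (Suc n) \<le> \<tau> k x \<longrightarrow> u (Suc n) x \<le> 2 powr k"
      unfolding \<tau>_def using AE_le_before_level_time[of u] u by blast
    then show ?thesis using gf f0
    proof eventually_elim
      case (elim x)
      show ?case
      proof (intro allI impI)
        fix k n assume n: "enat n \<le> \<tau> k x"
        show "U (\<lambda>j. g j x) n \<le> l * 2 powr k"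
        proof (cases n)
          case 0
          \<comment> \<open>The level times give no bound at the index \<open>0\<close>; here \<open>f 0 = 0\<close> is used.\<close>
          then show ?thesis using elim l by (simp add: at_0)
        next
          case (Suc m)
          then have "u n x \<le> 2 powr k" using elim(1) n by blast
          then show ?thesis using l by (simp add: u_def field_simps)
        qed
      qed
    qed
  qed
  define G where "G k n x = stop_seq (\<tau> (k + 1) x) (\<lambda>j. g j x) n - stop_seq (\<tau> k x) (\<lambda>j. g j x) n"
    for k n x
  define P where "P k m a \<longleftrightarrow> 0 < m \<and> var_atom fun_of M F p (\<tau> k) a \<and>
      (\<forall>n. AE x in M. m * real_cond_exp M (F n) a x = G k n x) \<and>
      (AE x in M. ennreal m * finite_ind M (\<tau> k) x / var_norm M p (finite_ind M (\<tau> k))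
        \<le> ennreal (4 * l * 2 powr k) * finite_ind M (\<tau> k) x)" for k m a
  have "\<exists>m a. P k m a" for k
    unfolding P_def
  proof (rule exists_normalized_atom[OF \<tau>])
    show "adapted_martingale (G k)"
      unfolding G_def by (intro adapted_martingale_diff adapted_martingale_stop mart \<tau>)
    show "0 < 4 * l * 2 powr k" using l by simp
    show "AE x in M. \<forall>n. U (\<lambda>j. G k j x) n \<le> 4 * l * 2 powr k"
      using below
    proof eventually_elim
      case (elim x)
      show ?case
      proof
        fix n
        have "U (\<lambda>j. G k j x) n \<le> 2 * (l * 2 powr (k + 1))"
          unfolding G_def
          by (rule U_stop_diff_le[OF mono]) (use elim[rule_format, of _ "k + 1"] in auto)
        then show "U (\<lambda>j. G k j x) n \<le> 4 * l * 2 powr k" by (simp add: powr_add)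
      qed
    qed
    show "G k n x = 0" if "enat n \<le> \<tau> k x" for n x
      using that order_trans[OF that mono[of k "k + 1" x]] by (simp add: G_def stop_seq_eq)
  qed
  then obtain \<mu> a where P: "\<And>k. P k (\<mu> k) (a k)" by metis
  have \<mu>: "0 < \<mu> k" and a: "var_atom fun_of M F p (\<tau> k) (a k)"
    and Ea: "AE x in M. \<mu> k * real_cond_exp M (F n) (a k) x = G k n x"
    and coeff: "AE x in M. ennreal (\<mu> k) * finite_ind M (\<tau> k) x / var_norm M p (finite_ind M (\<tau> k))
        \<le> ennreal (4 * l * 2 powr k) * finite_ind M (\<tau> k) x" for k n
    using P[of k] by (auto simp: P_def)
  have "AE x in M. ((\<lambda>k. \<mu> k * real_cond_exp M (F n) (a k) x) has_sum f n x) UNIV" for n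
  proof -
    have "AE x in M. \<forall>k. \<mu> k * real_cond_exp M (F n) (a k) x = G k n x"
      using Ea by (simp add: AE_all_countable)
    then show ?thesis using gf fin below
    proof eventually_elim
      case (elim x)
      obtain k0 where k0: "\<tau> k0 x = \<infinity>" using elim by blast
      have "((\<lambda>k. stop_seq (\<tau> (k + 1) x) (\<lambda>j. g j x) n - stop_seq (\<tau> k x) (\<lambda>j. g j x) n)
          has_sum g n x) UNIV"
      proof (rule has_sum_telescope_int[where s = "\<lambda>k. stop_seq (\<tau> k x) (\<lambda>j. g j x) n"])
        show "stop_seq (\<tau> k x) (\<lambda>j. g j x) n = g n x" if "k0 \<le> k" for k
          using mono[OF that, of x] k0 by simp
        show "\<bar>stop_seq (\<tau> k x) (\<lambda>j. g j x) n\<bar> \<le> real (n + 1) * l * 2 powr k" for k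
        proof (rule stop_seq_le[where P = "\<lambda>y. \<bar>y\<bar> \<le> real (n + 1) * l * 2 powr k"])
          fix m assume m: "m \<le> n" "enat m \<le> \<tau> k x"
          have "\<bar>g m x\<bar> \<le> real (m + 1) * U (\<lambda>j. g j x) m" using abs_le[of "\<lambda>j. g j x" m] .
          also have "\<dots> \<le> real (n + 1) * (l * 2 powr k)"
            using elim(4) m nonneg by (intro mult_mono) auto
          finally show "\<bar>g m x\<bar> \<le> real (n + 1) * l * 2 powr k" by (simp add: mult.assoc)
        qed
      qed
      then show ?case using elim(1,2) by (simp add: G_def)
    qed
  qed
  then have "atomic_decomposition fun_of M F p f \<mu> \<tau> a"
    unfolding atomic_decomposition_def using \<mu> a by blast
  moreover have "decomposition_norm M p t \<mu> \<tau> \<le> ennreal (atomic_const level_const t * l)"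
  proof (rule decomposition_norm_le[OF t l level_const_nonneg _ mono levels fin])
    show "AE x in M. \<forall>k. ennreal (\<mu> k) * finite_ind M (\<tau> k) x / var_norm M p (finite_ind M (\<tau> k))
        \<le> ennreal (4 * l * 2 powr k) * finite_ind M (\<tau> k) x"
      using coeff by (simp add: AE_all_countable)
  qed (rule stopping_time_ext_finite_sets[OF \<tau>])
  ultimately show ?thesis by blast
qed

lemma atomic_norm_le:
  assumes "martingale M F f" "f \<in> null_at_0 M" and t: "0 < t"
  shows "atomic_norm fun_of M F p t f \<le> ennreal (atomic_const level_const t) * hardy_norm fun_of M p f"
proof -
  let ?C = "atomic_const level_const t"
  have C: "0 < ?C" by (rule atomic_const_pos[OF t level_const_nonneg])
  have "atomic_norm fun_of M F p t f / ennreal ?C \<le> hardy_norm fun_of M p f"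
    unfolding hardy_norm_def var_norm_def
  proof (rule Inf_greatest, clarify)
    fix l :: real
    assume l: "0 < l" and int: "(\<integral>\<^sup>+ x. ennpowr (fun_of f x / ennreal l) (p x) \<partial>M) \<le> 1"
    obtain \<mu> \<tau> a where d: "atomic_decomposition fun_of M F p f \<mu> \<tau> a"
        "decomposition_norm M p t \<mu> \<tau> \<le> ennreal (?C * l)"
      using exists_atomic_decomposition[OF assms(1) _ t l int] assms(2) by (auto simp: null_at_0_def)
    have "atomic_norm fun_of M F p t f \<le> ennreal (?C * l)"
      unfolding atomic_norm_def using d by (intro Inf_lower2[OF _ d(2)]) auto
    then have "atomic_norm fun_of M F p t f / ennreal ?C \<le> ennreal (?C * l) / ennreal ?C"
      by (rule divide_right_mono_ennreal)
    also have "\<dots> = ennreal l" using C l by (simp add: divide_ennreal)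
    finally show "atomic_norm fun_of M F p t f / ennreal ?C \<le> ennreal l" .
  qed
  then have "ennreal ?C * (atomic_norm fun_of M F p t f / ennreal ?C) \<le> ennreal ?C * hardy_norm fun_of M p f"
    by (intro mult_left_mono) auto
  then show ?thesis using C
    by (simp add: ennreal_times_divide ennreal_mult_divide_eq mult.commute)
qed

lemma hardy_norm_le_atomic_norm:
  assumes "0 < t" "t \<le> 1"
  shows "hardy_norm fun_of M p f \<le> atomic_norm fun_of M F p t f"
  unfolding atomic_norm_def using hardy_norm_le_decomposition_norm[OF assms]
  by (intro Inf_greatest) auto

lemma hardy_space_eq_atomic_space:
  assumes t: "0 < t" "t \<le> 1"
  shows "hardy_space fun_of M F p \<inter> null_at_0 M = atomic_space fun_of M F p t"
    and "equivalent_on (atomic_space fun_of M F p t) (hardy_norm fun_of M p) (atomic_norm fun_of M F p t)"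
proof -
  let ?C = "atomic_const level_const t"
  have C: "0 < ?C" by (rule atomic_const_pos[OF t(1) level_const_nonneg])
  show "hardy_space fun_of M F p \<inter> null_at_0 M = atomic_space fun_of M F p t"
  proof (intro equalityI subsetI)
    fix f assume f: "f \<in> hardy_space fun_of M F p \<inter> null_at_0 M"
    then have "atomic_norm fun_of M F p t f \<le> ennreal ?C * hardy_norm fun_of M p f"
      using t by (intro atomic_norm_le) (auto simp: hardy_space_def)
    also have "\<dots> < \<infinity>" using f by (auto simp: hardy_space_def ennreal_mult_less_top)
    finally show "f \<in> atomic_space fun_of M F p t" using f by (auto simp: hardy_space_def atomic_space_def)
  next
    fix f assume f: "f \<in> atomic_space fun_of M F p t"
    then show "f \<in> hardy_space fun_of M F p \<inter> null_at_0 M"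
      using subsetD[OF atomic_space_null_at_0 f] hardy_norm_le_atomic_norm[OF t, of f]
      by (auto simp: hardy_space_def atomic_space_def intro: le_less_trans)
  qed
  have "ennreal 1 * hardy_norm fun_of M p f \<le> atomic_norm fun_of M F p t f \<and>
      atomic_norm fun_of M F p t f \<le> ennreal ?C * hardy_norm fun_of M p f"
    if f: "f \<in> atomic_space fun_of M F p t" for f
  proof -
    have "f \<in> null_at_0 M" using f atomic_space_null_at_0 by blast
    then show ?thesis
      using f hardy_norm_le_atomic_norm[OF t, of f] atomic_norm_le[of f t] t
      by (simp add: atomic_space_def)
  qed
  then show "equivalent_on (atomic_space fun_of M F p t) (hardy_norm fun_of M p) (atomic_norm fun_of M F p t)"
    unfolding equivalent_on_def using C by (intro exI[of _ 1] exI[of _ ?C]) auto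
qed

end

theorem theorem3p5:
  fixes M :: "'a measure" and F :: "nat \<Rightarrow> 'a measure" and p :: "'a \<Rightarrow> real" and K t :: real
  assumes "prob_space M" and "complete_measure M"
    and "\<And>n. subalgebra M (F n)" and "filtration (space M) F"
    and "sets M = sets (completion (restr_to_subalg M (sigma (space M) (\<Union>n. sets (F n)))))"
    and "\<And>n. generated_by_countably_many_atoms M (F n)"
    and "p \<in> borel_measurable M" and "\<And>x. x \<in> space M \<Longrightarrow> 0 < p x"
    and "0 < p_minus M p (space M)" and "p_plus M p (space M) < \<infinity>"
    and "K \<ge> 1"
    and "\<And>n A. atom_of M (F n) A \<Longrightarrow>
           measure M A powr real_of_ereal (p_minus M p A - p_plus M p A) \<le> K"
    and "regular_filtration M F"
    and "0 < t" and "ereal t < min (p_minus M p (space M)) 1"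
  shows "hardy_space square_fun M F p \<inter> null_at_0 M = atomic_space square_fun M F p t
       \<and> equivalent_on (atomic_space square_fun M F p t)
           (hardy_norm square_fun M p) (atomic_norm square_fun M F p t)
       \<and> hardy_space maximal_fun M F p \<inter> null_at_0 M = atomic_space maximal_fun M F p t
       \<and> equivalent_on (atomic_space maximal_fun M F p t)
           (hardy_norm maximal_fun M p) (atomic_norm maximal_fun M F p t)"
proof -
  interpret prob_space M by fact
  interpret filtration "space M" F by fact
  interpret fps: filtered_prob_space M F
    by unfold_locales (use assms(3) sets_F_mono in auto)
  obtain q where q: "0 < ereal q" "ereal q < p_minus M p (space M)"
    using ereal_dense2[OF assms(9)] by blast
  obtain r where r: "p_plus M p (space M) < ereal r"
    using ereal_dense2[OF assms(10)] by blast
  have p [measurable]: "p \<in> borel_measurable M" by fact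
  have AE_restrict: "AE x in M. P x" if "AE x in restrict_space M (space M). P x" for P
  proof -
    have "AE x in M. x \<in> space M \<longrightarrow> P x" using that by (subst (asm) AE_restrict_space_iff) auto
    then show ?thesis using AE_space by eventually_elim simp
  qed
  have "AE x in M. ereal (p x) \<le> p_plus M p (space M)"
    unfolding p_plus_def by (rule AE_restrict[OF esssup_AE])
  moreover have "AE x in M. - ereal (p x) \<le> esssup (restrict_space M (space M)) (\<lambda>x. - ereal (p x))"
    by (rule AE_restrict[OF esssup_AE])
  ultimately have "AE x in M. q \<le> p x \<and> p x \<le> r"
  proof eventually_elim
    case (elim x)
    have "p_minus M p (space M) \<le> ereal (p x)"
      using elim(2) unfolding p_minus_def essinf_def by (subst ereal_uminus_le_reorder)
    then have "ereal q < ereal (p x)" using q(2) by (rule less_le_trans[rotated])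
    moreover have "ereal (p x) < ereal r" using elim(1) r by (rule le_less_trans)
    ultimately show ?case by simp
  qed
  then interpret ve: variable_exponent M p q r
    by unfold_locales (use q in auto)
  obtain R where R: "0 < R" "\<And>n A. 1 \<le> n \<Longrightarrow> A \<in> sets (F n) \<Longrightarrow>
      \<exists>B\<in>sets (F (n - 1)). A \<subseteq> B \<and> prob B \<le> R * prob A"
    using assms(13) by (auto simp: regular_filtration_def)
  have R': "\<exists>B\<in>sets (F n). A \<subseteq> B \<and> prob B \<le> max 1 R * prob A"
    if A: "A \<in> sets (F (Suc n))" for n A
  proof -
    obtain B where B: "B \<in> sets (F n)" "A \<subseteq> B" "prob B \<le> R * prob A"
      using R(2)[of "Suc n" A] A by auto
    have "R * prob A \<le> max 1 R * prob A" by (intro mult_right_mono) auto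
    with B(3) have "prob B \<le> max 1 R * prob A" by (rule order_trans)
    with B show ?thesis by blast
  qed
  have "\<exists>D :: nat \<Rightarrow> 'a set. (\<forall>i. atom_of M (F n) (D i)) \<and> disjoint_family D \<and> (\<Union>i. D i) = space M" for n
    by (rule atom_partition[OF assms(3) finite_measure_axioms assms(6)]) blast
  then obtain D :: "nat \<Rightarrow> nat \<Rightarrow> 'a set" where D: "\<And>n i. atom_of M (F n) (D n i)"
      "\<And>n. disjoint_family (D n)" "\<And>n. (\<Union>i. D n i) = space M"
    by metis
  interpret raf: regular_atomic_filtration M F p q r D "max 1 R" K
    by unfold_locales (use D R' assms(11,12) in auto)
  interpret sq: hardy_setting M F p q r D "max 1 R" K square_seminorm
    unfolding hardy_setting_def
    using raf.regular_atomic_filtration_axioms fps.martingale_seminorm_square by blast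
  interpret mx: hardy_setting M F p q r D "max 1 R" K max_seminorm
    unfolding hardy_setting_def
    using raf.regular_atomic_filtration_axioms fps.martingale_seminorm_max by blast
  have t: "0 < t" "t \<le> 1" using assms(14,15) by auto
  show ?thesis
    unfolding square_fun_eq maximal_fun_eq
    using sq.hardy_space_eq_atomic_space[OF t] mx.hardy_space_eq_atomic_space[OF t] by blast
qed

end
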